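(* Let $F=\{F_{\varsigma}\}_{\varsigma\in\mathfrak{A}}$ and $G=\{G_{\varsigma}\}_{\varsigma\in\mathfrak{A}}$ be two continuous frames for $\mathcal{H}$. The following hold: (1) If $S_F^{-1}\ge I$ and $S_FS_{FK}=S_{FK}S_F$ for all $K\subset\mathfrak{A}$, then $\{F_{\varsigma}\}_{\varsigma\in\mathfrak{A}}$ and $\{S_F^{-1}F_{\varsigma}\}_{\varsigma\in\mathfrak{A}}$ are continuous woven. (2) If $F$ and $G$ are two woven continuous Riesz bases for $\mathcal{H}$, and $T_1$ and $T_2$ are bounded invertible operators on $\mathcal{H}$ such that for every $K\subset\mathfrak{A}$ $$d_{F_K,G_{K^C}}>\max\{\|T_1-T_2\|\,\|T_1^{-1}\|,\ \|T_1-T_2\|\,\|T_2^{-1}\|\},$$ then $T_1F=\{T_1F_\varsigma\}_{\varsigma\in\mathfrak{A}}$ and $T_2G=\{T_2G_\varsigma\}_{\varsigma\in\mathfrak{A}}$ are continuous woven.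
   Context: $\mathcal{H}$ is a separable Hilbert space, $I$ its identity operator, and $(\mathfrak{A},\mu)$ a measure space with positive measure $\mu$. All families $\{F_\varsigma\}_{\varsigma\in\mathfrak{A}}\subset\mathcal{H}$ are such that $\varsigma\mapsto\langle f,F_\varsigma\rangle$ is measurable for each $f\in\mathcal{H}$; vector-valued integrals are understood weakly; subsets $K$ of $\mathfrak{A}$ are measurable; $K^C$ is the complement of $K$. A family $F=\{F_\varsigma\}_{\varsigma\in\mathfrak{A}}$ is a continuous frame for $\mathcal{H}$ if there are constants $0<A_F\le B_F<\infty$ with $A_F\|f\|^2\le\int_{\mathfrak{A}}|\langle f,F_\varsigma\rangle|^2d\mu(\varsigma)\le B_F\|f\|^2$ for all $f\in\mathcal{H}$. Its frame operator is $S_Ff=\int_{\mathfrak{A}}\langle f,F_\varsigma\rangle F_\varsigma\,d\mu(\varsigma)$, a bounded, invertible, self-adjoint operator. For $K\subset\mathfrak{A}$, $S_{FK}f=\int_K\langle f,F_\varsigma\rangle F_\varsigma\,d\mu(\varsigma)$. The inequality $S_F^{-1}\ge I$ is in the sense of self-adjoint operators. $F$ is a continuous Riesz basis if $\overline{\mathrm{span}}\{F_\varsigma\}_{\varsigma\in\mathfrak{A}}=\mathcal{H}$ and there are constants $0<A\le B<\infty$ with $A\int_{\mathfrak{A}}|\alpha_\varsigma|^2d\mu(\varsigma)\le\|\int_{\mathfrak{A}}\alpha_\varsigma F_\varsigma d\mu(\varsigma)\|^2\le B\int_{\mathfrak{A}}|\alpha_\varsigma|^2d\mu(\varsigma)$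 for all $\{\alpha_\varsigma\}\in L^2(\mathfrak{A},\mu)$. Two families $\{F_\varsigma\}$ and $\{G_\varsigma\}$ are continuous woven if there are universal constants $0<A\le B<\infty$ such that for every $K\subset\mathfrak{A}$ the family $\{F_\varsigma\}_{\varsigma\in K}\cup\{G_\varsigma\}_{\varsigma\in K^C}$ is a continuous frame for $\mathcal{H}$ with bounds $A$ and $B$, i.e. $A\|f\|^2\le\int_K|\langle f,F_\varsigma\rangle|^2d\mu(\varsigma)+\int_{K^C}|\langle f,G_\varsigma\rangle|^2d\mu(\varsigma)\le B\|f\|^2$ for all $f\in\mathcal{H}$. For subspaces $U_1,U_2$ of $\mathcal{H}$, with $S_{U_i}=S_{\mathcal{H}}\cap U_i$ where $S_{\mathcal{H}}$ is the unit sphere of $\mathcal{H}$, put $d_{U_1}(U_2)=\inf\{\|f-g\|: f\in U_1,\ g\in S_{U_2}\}$, $d_{U_2}(U_1)=\inf\{\|f-g\|: f\in S_{U_1},\ g\in U_2\}$ (infimum over the empty set being $+\infty$), and $d(U_1,U_2)=\min\{d_{U_1}(U_2),d_{U_2}(U_1)\}$. For $K\subset\mathfrak{A}$, $d_{F_K,G_{K^C}}=d(\overline{\mathrm{span}}\{F_\varsigma\}_{\varsigma\in K},\overline{\mathrm{span}}\{G_\varsigma\}_{\varsigma\in K^C})$. *)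

theory Defs
  imports "HOL-Analysis.Analysis"
begin

text \<open>
  The scalars of a Hilbert space are the real or the complex numbers. Both cases are covered
  uniformly by the class below: its axioms force the conjugate of a nonzero scalar z to be
  |z|^2 / z, and by the Gelfand-Mazur theorem \<open>real\<close> and \<open>complex\<close> are, up to isomorphism, its
  only instances.
\<close>

class rc_scalar = real_normed_field + banach + second_countable_topology +
  fixes sconj :: "'a \<Rightarrow> 'a"
  assumes sconj_add: "sconj (a + b) = sconj a + sconj b"
    and sconj_mult: "sconj (a * b) = sconj a * sconj b"
    and mult_sconj: "a * sconj a = scaleR ((norm a)\<^sup>2) 1"

instantiation real :: rc_scalar
begin
definition sconj_real_def [simp]: "sconj (x::real) = x"
instance by standard (auto simp: power2_eq_square)
end

instantiation complex :: rc_scalar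
begin
definition sconj_complex_def [simp]: "sconj (z::complex) = cnj z"
instance by standard (auto simp: complex_norm_square scaleR_conv_of_real simp flip: of_real_power)
end

text \<open>
  Completeness and separability of the space are expressed by the sort of \<open>'h\<close>: a metric space is
  separable iff it is second countable. The norm of \<open>'h\<close> is the one induced by the inner product
  \<open>ip\<close>, which is linear in its first argument.
\<close>

locale separable_hilbert = vs: vector_space smul
  for smul :: "'k::rc_scalar \<Rightarrow> 'h::{banach, second_countable_topology} \<Rightarrow> 'h" +
  fixes ip :: "'h \<Rightarrow> 'h \<Rightarrow> 'k"
  assumes scale_of_real: "smul (of_real r) x = r *\<^sub>R x"
    and ip_add_left: "ip (x + y) z = ip x z + ip y z"
    and ip_scale_left: "ip (smul c x) y = c * ip x y"
    and ip_commute: "ip y x = sconj (ip x y)"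
    and ip_self: "ip x x = of_real ((norm x)\<^sup>2)"

lemma separable_hilbert_real:
  "separable_hilbert scaleR (inner :: 'h::{real_inner, banach, second_countable_topology} \<Rightarrow> _)"
  by unfold_locales
    (auto simp: algebra_simps inner_commute power2_norm_eq_inner)

lemma separable_hilbert_complex: "separable_hilbert (*) (\<lambda>x y::complex. x * cnj y)"
  by unfold_locales
    (auto simp: algebra_simps scaleR_conv_of_real complex_norm_square simp flip: of_real_power)


subsection \<open>Continuous frames\<close>

definition weakly_measurable :: "('h \<Rightarrow> 'h \<Rightarrow> 'k::rc_scalar) \<Rightarrow> 's measure \<Rightarrow> ('s \<Rightarrow> 'h) \<Rightarrow> bool"
  where "weakly_measurable ip M F \<longleftrightarrow> (\<forall>f. (\<lambda>s. ip f (F s)) \<in> borel_measurable M)"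

definition continuous_frame ::
    "('h::real_normed_vector \<Rightarrow> 'h \<Rightarrow> 'k::rc_scalar) \<Rightarrow> 's measure \<Rightarrow> ('s \<Rightarrow> 'h) \<Rightarrow> bool"
  where "continuous_frame ip M F \<longleftrightarrow> weakly_measurable ip M F \<and>
    (\<exists>A B. 0 < A \<and> A \<le> B \<and>
      (\<forall>f. ennreal (A * (norm f)\<^sup>2) \<le> (\<integral>\<^sup>+s. ennreal ((norm (ip f (F s)))\<^sup>2) \<partial>M) \<and>
           (\<integral>\<^sup>+s. ennreal ((norm (ip f (F s)))\<^sup>2) \<partial>M) \<le> ennreal (B * (norm f)\<^sup>2)))"

definition continuous_woven ::
    "('h::real_normed_vector \<Rightarrow> 'h \<Rightarrow> 'k::rc_scalar) \<Rightarrow> 's measure \<Rightarrow> ('s \<Rightarrow> 'h) \<Rightarrow> ('s \<Rightarrow> 'h) \<Rightarrow> bool"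
  where "continuous_woven ip M F G \<longleftrightarrow> weakly_measurable ip M F \<and> weakly_measurable ip M G \<and>
    (\<exists>A B. 0 < A \<and> A \<le> B \<and>
      (\<forall>K \<in> sets M. \<forall>f.
        (let w = (\<integral>\<^sup>+s\<in>K. ennreal ((norm (ip f (F s)))\<^sup>2) \<partial>M)
               + (\<integral>\<^sup>+s\<in>space M - K. ennreal ((norm (ip f (G s)))\<^sup>2) \<partial>M)
         in ennreal (A * (norm f)\<^sup>2) \<le> w \<and> w \<le> ennreal (B * (norm f)\<^sup>2))))"


subsection \<open>Weak integrals, frame operators and Riesz bases\<close>

text \<open>
  \<open>has_weak_integral ip M K \<phi> v\<close>: \<open>v\<close> is the weak integral over \<open>K\<close> of the vector-valued
  function \<open>\<phi>\<close>. In a \<open>separable_hilbert\<close> space such a \<open>v\<close> is unique.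
\<close>

definition has_weak_integral ::
    "('h \<Rightarrow> 'h \<Rightarrow> 'k::rc_scalar) \<Rightarrow> 's measure \<Rightarrow> 's set \<Rightarrow> ('s \<Rightarrow> 'h) \<Rightarrow> 'h \<Rightarrow> bool"
  where "has_weak_integral ip M K \<phi> v \<longleftrightarrow>
    (\<forall>h. set_integrable M K (\<lambda>s. ip (\<phi> s) h) \<and> ip v h = (LINT s:K|M. ip (\<phi> s) h))"

definition partial_frame_op ::
    "('k::rc_scalar \<Rightarrow> 'h \<Rightarrow> 'h) \<Rightarrow> ('h \<Rightarrow> 'h \<Rightarrow> 'k) \<Rightarrow> 's measure \<Rightarrow> ('s \<Rightarrow> 'h) \<Rightarrow> 's set \<Rightarrow> 'h \<Rightarrow> 'h"
  where "partial_frame_op smul ip M F K f =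
    (THE v. has_weak_integral ip M K (\<lambda>s. smul (ip f (F s)) (F s)) v)"

definition frame_op ::
    "('k::rc_scalar \<Rightarrow> 'h \<Rightarrow> 'h) \<Rightarrow> ('h \<Rightarrow> 'h \<Rightarrow> 'k) \<Rightarrow> 's measure \<Rightarrow> ('s \<Rightarrow> 'h) \<Rightarrow> 'h \<Rightarrow> 'h"
  where "frame_op smul ip M F = partial_frame_op smul ip M F (space M)"

text \<open>The order \<open>T \<ge> U\<close>, to be used for self-adjoint operators only.\<close>

definition operator_ge ::
    "('h::minus \<Rightarrow> 'h \<Rightarrow> 'k::rc_scalar) \<Rightarrow> ('h \<Rightarrow> 'h) \<Rightarrow> ('h \<Rightarrow> 'h) \<Rightarrow> bool"
  where "operator_ge ip T U \<longleftrightarrow> (\<forall>f. \<exists>r::real. r \<ge> 0 \<and> ip (T f - U f) f = of_real r)"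

definition closed_span ::
    "('k::rc_scalar \<Rightarrow> 'h::{ab_group_add, topological_space} \<Rightarrow> 'h) \<Rightarrow> 'h set \<Rightarrow> 'h set"
  where "closed_span smul X = closure (module.span smul X)"

text \<open>
  The weak integral \<open>v\<close> of \<open>\<alpha> F\<close> is required to exist for every square integrable \<open>\<alpha>\<close>;
  for a continuous frame this is automatic.
\<close>

definition continuous_riesz_basis ::
    "('k::rc_scalar \<Rightarrow> 'h::real_normed_vector \<Rightarrow> 'h) \<Rightarrow> ('h \<Rightarrow> 'h \<Rightarrow> 'k) \<Rightarrow> 's measure \<Rightarrow> ('s \<Rightarrow> 'h) \<Rightarrow> bool"
  where "continuous_riesz_basis smul ip M F \<longleftrightarrow> weakly_measurable ip M F \<and>
    closed_span smul (F ` space M) = UNIV \<and>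
    (\<exists>A B. 0 < A \<and> A \<le> B \<and>
      (\<forall>\<alpha>::'s \<Rightarrow> 'k. \<alpha> \<in> borel_measurable M \<and> integrable M (\<lambda>s. (norm (\<alpha> s))\<^sup>2) \<longrightarrow>
        (\<exists>v. has_weak_integral ip M (space M) (\<lambda>s. smul (\<alpha> s) (F s)) v \<and>
             A * (LINT s|M. (norm (\<alpha> s))\<^sup>2) \<le> (norm v)\<^sup>2 \<and>
             (norm v)\<^sup>2 \<le> B * (LINT s|M. (norm (\<alpha> s))\<^sup>2))))"


subsection \<open>Invertible operators and the distance between subspaces\<close>

definition bounded_operator ::
    "('k::rc_scalar \<Rightarrow> 'h::real_normed_vector \<Rightarrow> 'h) \<Rightarrow> ('h \<Rightarrow> 'h) \<Rightarrow> bool"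
  where "bounded_operator smul T \<longleftrightarrow> bounded_linear T \<and> (\<forall>c x. T (smul c x) = smul c (T x))"

definition bounded_invertible_operator ::
    "('k::rc_scalar \<Rightarrow> 'h::real_normed_vector \<Rightarrow> 'h) \<Rightarrow> ('h \<Rightarrow> 'h) \<Rightarrow> bool"
  where "bounded_invertible_operator smul T \<longleftrightarrow>
    bounded_operator smul T \<and> bij T \<and> bounded_operator smul (inv T)"

text \<open>
  \<open>dist_to_sphere U V\<close> is the infimum of \<open>norm (f - g)\<close> over \<open>f\<close> in \<open>U\<close> and \<open>g\<close> in the unit sphere
  of \<open>V\<close>. It is \<open>ereal\<close>-valued because the infimum over the empty set (\<open>V = {0}\<close>) must be
  infinite.
\<close>

definition dist_to_sphere :: "'h::real_normed_vector set \<Rightarrow> 'h set \<Rightarrow> ereal"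
  where "dist_to_sphere U V = Inf {ereal (norm (f - g)) |f g. f \<in> U \<and> g \<in> sphere 0 1 \<inter> V}"

definition subspace_dist :: "'h::real_normed_vector set \<Rightarrow> 'h set \<Rightarrow> ereal"
  where "subspace_dist U V = min (dist_to_sphere U V) (dist_to_sphere V U)"

end

theory Submission
  imports Defs "HOL-Library.Diagonal_Subsequence"
begin

text \<open>
  Write \<open>q\<^sub>K f\<close> for the integral of \<open>|\<langle>f, F\<^sub>s\<rangle>|\<^sup>2\<close> over \<open>K\<close>; this is \<open>\<langle>S\<^sub>K f, f\<rangle>\<close> for the partial frame
  operator \<open>S\<^sub>K\<close>. In both parts the upper bound of a weaving is immediate, and the matter is a lower
  bound that does not depend on \<open>K\<close>.

  \<^bold>\<open>The canonical dual.\<close> The frame operator \<open>S\<close> is self-adjoint, so the weaving of \<open>F\<close> and \<open>S\<^sup>-\<^sup>1F\<close>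
  along \<open>K\<close> has the energy \<open>q\<^sub>K f + q\<^sub>L (S\<^sup>-\<^sup>1 f)\<close>, where \<open>L\<close> is the complement of \<open>K\<close>. From
  \<open>S\<^sup>-\<^sup>1 \<ge> I\<close> it follows that \<open>S\<close> is a contraction. As \<open>S\<close> commutes with \<open>S\<^sub>L\<close>, it is symmetric for the
  positive semidefinite form \<open>\<langle>S\<^sub>L x, y\<rangle>\<close>, and an argument of Lax (\<open>energy_contraction\<close>) shows that it
  is a contraction for that form too: \<open>q\<^sub>L f \<le> q\<^sub>L (S\<^sup>-\<^sup>1 f)\<close>. So the energy of the weaving is at
  least \<open>q\<^sub>K f + q\<^sub>L f\<close>, which is at least \<open>A \<parallel>f\<parallel>\<^sup>2\<close> by the lower frame bound of \<open>F\<close>.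

  \<^bold>\<open>The perturbation.\<close> Fix \<open>K\<close>, and let \<open>H\<close> be the weaving of \<open>F\<close> and \<open>G\<close> along \<open>K\<close>, a frame. Given
  \<open>f\<close>, expand \<open>h = T\<^sub>1\<^sup>-\<^sup>1 f\<close> in \<open>H\<close>: this writes \<open>h = u + v\<close>, where \<open>u\<close> is a superposition of the
  \<open>F\<^sub>s\<close> with \<open>s\<close> in \<open>K\<close> and \<open>v\<close> one of the \<open>G\<^sub>s\<close> with \<open>s\<close> outside \<open>K\<close>. The distance hypothesis bounds
  \<open>v\<close> by \<open>h\<close> so well that \<open>T\<^sub>1 u + T\<^sub>2 v = f - (T\<^sub>1 - T\<^sub>2) v\<close> differs from \<open>f\<close> by at most a fixed
  fraction, less than one, of \<open>\<parallel>f\<parallel>\<close>. Thus \<open>f\<close> is seen by a superposition, with controlled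
  coefficients, of the perturbed weaving, which gives a lower bound for it (\<open>perturbed_energy_lower_bound\<close>).

  The hypothesis is a strict inequality for each \<open>K\<close> separately, so this lower bound depends on \<open>K\<close>.
  It becomes uniform because two Bessel families all of whose weavings are frames are woven
  (\<open>woven_if_every_weaving_bounded_below\<close>). Otherwise unit vectors \<open>f\<^sub>n\<close> exist along
  which the best weavings have energy tending to \<open>0\<close>. Fatou's lemma shows that a weak limit of them
  has a weaving of energy \<open>0\<close>, so the limit is \<open>0\<close>, and all coefficients of \<open>f\<^sub>n\<close> tend to \<open>0\<close> pointwise.
  Then a subsequence lives essentially on disjoint sets \<open>D\<^sub>j\<close> (\<open>gliding_hump\<close>), and using
  on each \<open>D\<^sub>j\<close> the weaving that is best for the \<open>j\<close>-th vector produces one single weaving without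
  lower bound.
\<close>


section \<open>Conjugation and real parts of scalars\<close>

lemma sconj_zero [simp]: "sconj (0::'k::rc_scalar) = 0"
  using sconj_add[of "0::'k" 0] by simp

lemma sconj_one [simp]: "sconj (1::'k::rc_scalar) = 1"
  using mult_sconj[of "1::'k"] by simp

lemma sconj_of_real [simp]: "sconj (of_real r) = (of_real r :: 'k::rc_scalar)"
proof (cases "r = 0")
  case False
  have "of_real r * sconj (of_real r) = (of_real r * of_real r :: 'k)"
    using mult_sconj[of "of_real r :: 'k"]
    by (simp add: scaleR_conv_of_real power2_eq_square flip: of_real_mult)
  then show ?thesis using False by simp
qed simp

lemma norm_sconj [simp]: "norm (sconj z) = norm (z::'k::rc_scalar)"
proof (cases "z = 0")
  case False
  have "norm z * norm (sconj z) = norm z * norm z"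
    using arg_cong[OF mult_sconj[of z], of norm]
    by (simp add: norm_mult power2_eq_square)
  then show ?thesis using False by simp
qed simp

lemma sconj_sconj [simp]: "sconj (sconj z) = (z::'k::rc_scalar)"
proof (cases "z = 0")
  case False
  then have nz: "sconj z \<noteq> 0" by (metis norm_sconj norm_eq_zero)
  have "sconj z * sconj (sconj z) = sconj z * z"
    using mult_sconj[of "sconj z"] mult_sconj[of z] by (simp add: mult.commute)
  then show ?thesis using nz by simp
qed simp

lemma bounded_linear_sconj: "bounded_linear (sconj :: 'k::rc_scalar \<Rightarrow> 'k)"
  by (rule bounded_linear_intro[where K = 1])
    (auto simp: sconj_add sconj_mult scaleR_conv_of_real)

text \<open>
  The scalar \<open>z + sconj z\<close> is real, because \<open>|1 + z|\<^sup>2 = 1 + z + sconj z + |z|\<^sup>2\<close>. Solving for it gives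
  the real part in terms of the norm alone.
\<close>

definition re_part :: "'k::rc_scalar \<Rightarrow> real"
  where "re_part z = ((norm (1 + z))\<^sup>2 - 1 - (norm z)\<^sup>2) / 2"

lemma of_real_re_part: "of_real (2 * re_part z) = z + sconj (z::'k::rc_scalar)"
proof -
  have "of_real ((norm (1 + z))\<^sup>2) = (1 + z) * (1 + sconj z)"
    using mult_sconj[of "1 + z"] by (simp add: sconj_add scaleR_conv_of_real)
  also have "\<dots> = 1 + z + sconj z + of_real ((norm z)\<^sup>2)"
    using mult_sconj[of z] by (simp add: algebra_simps scaleR_conv_of_real)
  finally show ?thesis by (simp add: re_part_def)
qed

lemma re_part_eqI: "of_real (2 * r) = z + sconj z \<Longrightarrow> re_part z = r"
  using of_real_re_part[of z] by (metis mult_cancel_left of_real_eq_iff zero_neq_numeral)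

lemma re_part_sconj [simp]: "re_part (sconj z) = re_part z"
  by (rule re_part_eqI) (simp only: of_real_re_part sconj_sconj add.commute)

lemma re_part_of_real [simp]: "re_part (of_real r) = r"
  by (rule re_part_eqI) simp

lemma re_part_zero [simp]: "re_part 0 = 0"
  using re_part_of_real[of 0] by simp

lemma re_part_mult_sconj [simp]: "re_part (z * sconj z) = (norm z)\<^sup>2"
  by (simp add: mult_sconj scaleR_conv_of_real del: of_real_power)

lemma abs_re_part_le: "\<bar>re_part z\<bar> \<le> norm z"
proof -
  have "\<bar>2 * re_part z\<bar> = norm (z + sconj z)"
    by (metis norm_of_real of_real_re_part)
  also have "\<dots> \<le> 2 * norm z" using norm_triangle_ineq[of z "sconj z"] by simp
  finally show ?thesis by simp
qed

lemma bounded_linear_re_part: "bounded_linear (re_part :: 'k::rc_scalar \<Rightarrow> real)"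
proof (rule bounded_linear_intro[where K = 1])
  show "re_part (x + y) = re_part x + re_part y" for x y :: 'k
    by (rule re_part_eqI)
      (simp only: distrib_left of_real_add of_real_re_part sconj_add add_ac)
  show "re_part (r *\<^sub>R x) = r *\<^sub>R re_part x" for r and x :: 'k
  proof (rule re_part_eqI)
    have "of_real (2 * r *\<^sub>R re_part x) = (of_real r * of_real (2 * re_part x) :: 'k)" by simp
    then show "of_real (2 * r *\<^sub>R re_part x) = r *\<^sub>R x + sconj (r *\<^sub>R x)"
      by (simp only: of_real_re_part scaleR_conv_of_real sconj_mult sconj_of_real distrib_left)
  qed
  show "norm (re_part x) \<le> norm x * 1" for x :: 'k using abs_re_part_le[of x] by simp
qed

lemmas re_part_add = linear_add[OF bounded_linear.linear[OF bounded_linear_re_part]]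
  and re_part_diff = linear_diff[OF bounded_linear.linear[OF bounded_linear_re_part]]
  and re_part_scaleR = linear_scale[OF bounded_linear.linear[OF bounded_linear_re_part]]

lemma re_part_separates:
  assumes "\<And>c. re_part (c * z) = re_part (c * w)"
  shows "z = w"
proof -
  have "re_part ((z - w) * sconj (z - w)) = 0"
    using assms[of "sconj (z - w)"] by (simp add: algebra_simps re_part_diff)
  then show ?thesis by simp
qed

lemma imaginary_square:
  assumes "re_part (u::'k::rc_scalar) = 0" shows "u * u = - of_real ((norm u)\<^sup>2)"
proof -
  have "sconj u = - u"
    using of_real_re_part[of u] assms by (simp add: add_eq_0_iff)
  then show ?thesis using mult_sconj[of u] by (simp add: scaleR_conv_of_real) (metis minus_minus)
qed

text \<open>
  Convergence of scalars has to be deduced from convergence of real parts. This needs that scalars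
  are spanned over the reals by \<open>1\<close> and at most one further unit \<open>i\<close>: two purely imaginary scalars
  of norm \<open>1\<close> both have square \<open>-1\<close>, so in a field they agree up to sign.
\<close>

lemma norm_le_two_re_parts: "\<exists>i::'k::rc_scalar. \<forall>z. norm z \<le> \<bar>re_part z\<bar> + \<bar>re_part (i * z)\<bar>"
proof (cases "\<exists>u::'k. re_part u = 0 \<and> u \<noteq> 0")
  case False
  have "norm z = \<bar>re_part z\<bar>" for z :: 'k
  proof -
    have "re_part (z - of_real (re_part z)) = 0" by (simp add: re_part_diff)
    then have "z = of_real (re_part z)" using False by auto
    then show ?thesis by (metis norm_of_real)
  qed
  then show ?thesis by (intro exI[of _ 0]) simp
next
  case True
  then obtain u :: 'k where u: "re_part u = 0" "u \<noteq> 0" by blast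
  define i where "i = u /\<^sub>R norm u"
  have i: "re_part i = 0" "norm i = 1" using u by (simp_all add: i_def re_part_scaleR)
  then have ii: "i * i = -1" using imaginary_square[of i] by simp
  show ?thesis
  proof (intro exI[of _ i] allI)
    fix z :: 'k
    define v where "v = z - of_real (re_part z)"
    have v: "re_part v = 0" by (simp add: v_def re_part_diff)
    have "(i * v - of_real (norm v)) * (i * v + of_real (norm v)) = (i * i) * (v * v) - of_real ((norm v)\<^sup>2)"
      by (simp add: algebra_simps power2_eq_square)
    also have "\<dots> = 0" using ii imaginary_square[OF v] by simp
    finally have "i * v = of_real (norm v) \<or> i * v = of_real (- norm v)"
      by (auto simp: eq_neg_iff_add_eq_0)
    then have "\<bar>re_part (i * v)\<bar> = norm v" by (metis abs_minus_cancel abs_norm_cancel re_part_of_real)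
    moreover have "i * z = i * v + re_part z *\<^sub>R i"
      by (simp add: v_def algebra_simps scaleR_conv_of_real)
    ultimately have "\<bar>re_part (i * z)\<bar> = norm v" using i by (simp add: re_part_add re_part_scaleR)
    moreover have "norm z \<le> \<bar>re_part z\<bar> + norm v"
      using norm_triangle_ineq[of "of_real (re_part z)" v] by (simp add: v_def)
    ultimately show "norm z \<le> \<bar>re_part z\<bar> + \<bar>re_part (i * z)\<bar>" by simp
  qed
qed


section \<open>Geometry of the Hilbert space\<close>

context separable_hilbert
begin

lemma ip_scale_right: "ip x (smul c y) = sconj c * ip x y"
  unfolding ip_commute[of x] ip_scale_left sconj_mult ..

lemma ip_scaleR_left: "ip (r *\<^sub>R x) y = r *\<^sub>R ip x y"
  unfolding scale_of_real[symmetric] ip_scale_left scaleR_conv_of_real ..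

lemma norm_smul: "norm (smul c x) = norm c * norm x"
proof -
  have "of_real ((norm (smul c x))\<^sup>2) = (c * sconj c) * ip x x"
    by (simp only: ip_self[symmetric] ip_scale_left ip_scale_right mult_ac)
  also have "\<dots> = of_real ((norm c)\<^sup>2 * (norm x)\<^sup>2)"
    by (simp only: mult_sconj ip_self scaleR_conv_of_real of_real_mult mult_1_right)
  finally have "(norm (smul c x))\<^sup>2 = (norm c * norm x)\<^sup>2"
    by (simp only: of_real_eq_iff power_mult_distrib)
  then show ?thesis by (simp add: power2_eq_iff_nonneg)
qed

definition rip :: "'h \<Rightarrow> 'h \<Rightarrow> real"
  where "rip x y = re_part (ip x y)"

lemma rip_commute: "rip x y = rip y x"
  unfolding rip_def ip_commute[of x] re_part_sconj ..

lemma rip_add_left: "rip (x + y) z = rip x z + rip y z"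
  by (simp add: rip_def ip_add_left re_part_add)

lemma rip_scaleR_left: "rip (r *\<^sub>R x) y = r * rip x y"
  by (simp add: rip_def ip_scaleR_left re_part_scaleR)

lemma rip_diff_left: "rip (x - y) z = rip x z - rip y z"
  using rip_add_left[of x "(-1) *\<^sub>R y" z] by (simp only: rip_scaleR_left) simp

lemma rip_add_right: "rip z (x + y) = rip z x + rip z y"
  and rip_diff_right: "rip z (x - y) = rip z x - rip z y"
  and rip_scaleR_right: "rip z (r *\<^sub>R x) = r * rip z x"
  by (simp_all only: rip_commute[of z] rip_add_left rip_diff_left rip_scaleR_left)

lemmas rip_linear = rip_add_left rip_diff_left rip_scaleR_left
  rip_add_right rip_diff_right rip_scaleR_right

lemma rip_self: "rip x x = (norm x)\<^sup>2"
  by (simp add: rip_def ip_self del: of_real_power)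

lemma norm_add_square: "(norm (x + y))\<^sup>2 = (norm x)\<^sup>2 + 2 * rip x y + (norm y)\<^sup>2"
  unfolding rip_self[symmetric] rip_linear rip_commute[of y x] by simp

lemma norm_diff_square: "(norm (x - y))\<^sup>2 = (norm x)\<^sup>2 - 2 * rip x y + (norm y)\<^sup>2"
  unfolding rip_self[symmetric] rip_linear rip_commute[of y x] by simp

lemma rip_le: "rip x y \<le> norm x * norm y"
proof (cases "x = 0 \<or> y = 0")
  case True
  then show ?thesis
    using rip_scaleR_left[of 0 x y] rip_scaleR_right[of x 0 y] by auto
next
  case False
  have "0 \<le> (norm (norm y *\<^sub>R x - norm x *\<^sub>R y))\<^sup>2" by simp
  also have "\<dots> = 2 * (norm x * norm y) * (norm x * norm y - rip x y)"
    unfolding norm_diff_square by (simp add: rip_linear power2_eq_square algebra_simps)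
  finally show ?thesis using False
    by (smt (verit) mult_pos_pos zero_le_mult_iff zero_less_norm_iff)
qed

lemma norm_ip_le: "norm (ip x y) \<le> norm x * norm y"
proof (cases "ip x y = 0")
  case False
  let ?c = "sconj (ip x y) /\<^sub>R norm (ip x y)"
  have "ip x y * sconj (ip x y) = (norm (ip x y))\<^sup>2 *\<^sub>R 1" by (rule mult_sconj)
  then have "?c * ip x y = of_real (norm (ip x y))"
    using False by (simp add: scaleR_conv_of_real power2_eq_square field_simps)
  then have "rip (smul ?c x) y = norm (ip x y)"
    by (simp add: rip_def ip_scale_left)
  moreover have "norm (smul ?c x) = norm x" using False by (simp add: norm_smul)
  ultimately show ?thesis using rip_le[of "smul ?c x" y] by simp
qed simp

lemma bounded_linear_ip_left: "bounded_linear (\<lambda>x. ip x y)"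
  by (rule bounded_linear_intro[where K = "norm y"])
    (simp_all add: ip_add_left ip_scaleR_left norm_ip_le)

lemma bounded_linear_rip_left: "bounded_linear (\<lambda>x. rip x y)"
  unfolding rip_def
  by (rule bounded_linear_compose[OF bounded_linear_re_part bounded_linear_ip_left])

lemma ip_eqI: "(\<And>h. ip x h = ip y h) \<Longrightarrow> x = y"
proof -
  assume "\<And>h. ip x h = ip y h"
  then have "rip (x - y) (x - y) = 0" unfolding rip_diff_left by (simp add: rip_def)
  then show "x = y" by (simp add: rip_self)
qed

text \<open>Real parts recover a scalar-linear functional, as \<open>re_part (c * z)\<close> for all \<open>c\<close> determines \<open>z\<close>.\<close>

lemma ip_eq_if_rip_eq:
  assumes "\<And>c. rip (smul c x) y = re_part (c * w)" shows "ip x y = w"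
  by (rule re_part_separates) (use assms in \<open>simp only: rip_def ip_scale_left\<close>)

text \<open>
  The representer minimises \<open>\<parallel>x\<parallel>\<^sup>2 - 2 L x\<close> over \<open>U\<close>; by the parallelogram law every minimising sequence is
  a Cauchy sequence. With \<open>U = UNIV\<close> this is the Riesz representation theorem, and with \<open>L\<close> the pairing
  with a vector it is the orthogonal projection onto \<open>U\<close>.
\<close>

lemma representer_in_closed_subspace:
  fixes L :: "'h \<Rightarrow> real"
  assumes L: "bounded_linear L" and U: "closed U" "subspace U"
  shows "\<exists>v\<in>U. \<forall>x\<in>U. rip x v = L x"
proof -
  interpret L: bounded_linear L by fact
  define J where "J x = (norm x)\<^sup>2 - 2 * L x" for x
  obtain C where C: "\<bar>L x\<bar> \<le> norm x * C" for x using L.bounded by auto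
  have lower: "- C\<^sup>2 \<le> J x" for x
    using C[of x] zero_le_power2[of "norm x - C"] by (simp add: J_def power2_diff abs_le_iff)
  have ne: "U \<noteq> {}" using U(2) subspace_0 by blast
  define m where "m = Inf (J ` U)"
  have bdd: "bdd_below (J ` U)" using lower by (intro bdd_belowI2)
  have m_le: "m \<le> J x" if "x \<in> U" for x
    unfolding m_def using that bdd by (intro cInf_lower) auto
  have "\<exists>x\<in>U. J x < m + 1 / Suc n" for n
    using cInf_lessD[of "J ` U" "m + 1 / Suc n"] ne by (auto simp: m_def)
  then obtain X where X: "X n \<in> U" "J (X n) < m + 1 / Suc n" for n by metis
  have close: "(norm (X i - X j))\<^sup>2 \<le> 2 / Suc i + 2 / Suc j" for i j
  proof -
    have "(1/2) *\<^sub>R (X i + X j) \<in> U"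
      using X(1) U(2) by (simp add: subspace_add subspace_scale)
    then have "m \<le> J ((1/2) *\<^sub>R (X i + X j))" by (rule m_le)
    also have "\<dots> = (norm (X i + X j))\<^sup>2 / 4 - L (X i) - L (X j)"
      unfolding J_def L.scaleR L.add norm_scaleR power_mult_distrib by (simp add: power2_eq_square add_divide_distrib)
    also have "\<dots> = ((norm (X i))\<^sup>2 + 2 * rip (X i) (X j) + (norm (X j))\<^sup>2) / 4 - L (X i) - L (X j)"
      unfolding norm_add_square ..
    finally have "(norm (X i - X j))\<^sup>2 \<le> 2 * J (X i) + 2 * J (X j) - 4 * m"
      unfolding norm_diff_square J_def by argo
    then show ?thesis using X(2)[of i] X(2)[of j] by linarith
  qed
  have "Cauchy X"
  proof (rule CauchyI)
    fix e :: real assume e: "0 < e"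
    obtain N where N: "4 / e\<^sup>2 < real N" using reals_Archimedean2 by blast
    have "norm (X i - X j) < e" if ij: "i \<ge> N" "j \<ge> N" for i j
    proof -
      have N0: "0 < real N" using N e by (smt (verit) divide_nonneg_nonneg zero_le_power2)
      have "2 / real (Suc k) \<le> 2 / real N" if "k \<ge> N" for k
        using that N0 by (intro divide_left_mono) auto
      then have "(norm (X i - X j))\<^sup>2 \<le> 4 / real N"
        using close[of i j] ij by (smt (verit) add_divide_distrib)
      also have "\<dots> < e\<^sup>2" using N N0 e by (simp add: field_simps)
      finally show ?thesis using e by (meson less_eq_real_def power_less_imp_less_base)
    qed
    then show "\<exists>N. \<forall>i\<ge>N. \<forall>j\<ge>N. norm (X i - X j) < e" by blast
  qed
  then obtain v where v: "X \<longlonglongrightarrow> v" using Cauchy_convergent_iff convergent_def by blast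
  have vU: "v \<in> U" using U(1) X(1) v closed_sequentially by blast
  have "(\<lambda>n. J (X n)) \<longlonglongrightarrow> J v"
    unfolding J_def by (intro tendsto_intros v L.tendsto)
  moreover have "(\<lambda>n. m + 1 / real (Suc n)) \<longlonglongrightarrow> m + 0"
    by (intro tendsto_intros LIMSEQ_Suc lim_const_over_n)
  ultimately have Jv: "J v \<le> m"
    using X(2) by (intro LIMSEQ_le[where Y = "\<lambda>n. m + 1 / Suc n" and X = "\<lambda>n. J (X n)"])
      (auto intro!: exI[of _ 0] less_imp_le)
  have "rip x v = L x" if x: "x \<in> U" for x
  proof -
    define d where "d = rip x v - L x"
    define N where "N = (norm x)\<^sup>2"
    \<comment> \<open>a value of \<open>t\<close> that makes the increment \<open>2 t d + t\<^sup>2 N\<close> of \<open>J\<close> along \<open>x\<close> negative unless \<open>d = 0\<close>\<close>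
    define t where "t = - d / (N + 1)"
    have N: "0 \<le> N" by (simp add: N_def)
    have "v + t *\<^sub>R x \<in> U" using vU x U(2) by (simp add: subspace_add subspace_scale)
    then have "J v \<le> J (v + t *\<^sub>R x)" using m_le Jv by force
    also have "\<dots> = J v + 2 * t * d + t\<^sup>2 * N"
      unfolding J_def norm_add_square L.add L.scaleR d_def N_def norm_scaleR power_mult_distrib
        rip_scaleR_right rip_commute[of v x] by (simp add: algebra_simps)
    finally have "0 \<le> (2 * t * d + t\<^sup>2 * N) * (N + 1)\<^sup>2" by simp
    also have "\<dots> = 2 * (t * (N + 1)) * d * (N + 1) + (t * (N + 1))\<^sup>2 * N"
      by (simp add: power2_eq_square algebra_simps)
    also have "t * (N + 1) = - d" using N by (simp add: t_def)
    also have "2 * (- d) * d * (N + 1) + (- d)\<^sup>2 * N = - (d\<^sup>2 * (N + 2))"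
      by (simp add: power2_eq_square algebra_simps)
    finally have "d\<^sup>2 * (N + 2) \<le> 0" by simp
    then have "d = 0" using N by (simp add: mult_le_0_iff)
    then show ?thesis by (simp add: d_def)
  qed
  then show ?thesis using vU by blast
qed

lemma riesz_representation:
  fixes \<phi> :: "'h \<Rightarrow> 'k"
  assumes "bounded_linear \<phi>" and scale: "\<And>c x. \<phi> (smul c x) = c * \<phi> x"
  shows "\<exists>v. \<forall>x. ip x v = \<phi> x"
proof -
  have "bounded_linear (\<lambda>x. re_part (\<phi> x))"
    by (rule bounded_linear_compose[OF bounded_linear_re_part assms(1)])
  then obtain v where "rip x v = re_part (\<phi> x)" for x
    using representer_in_closed_subspace[of _ UNIV] by auto
  then have "ip x v = \<phi> x" for x
    by (intro ip_eq_if_rip_eq) (simp add: scale)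
  then show ?thesis by blast
qed

lemma adjoint_exists:
  assumes T: "bounded_operator smul T"
  shows "\<exists>T'. bounded_linear T' \<and> (\<forall>x y. ip x (T y) = ip (T' x) y)"
proof -
  have bl: "bounded_linear T" and sc: "\<And>c x. T (smul c x) = smul c (T x)"
    using T unfolding bounded_operator_def by blast+
  have "\<exists>v. \<forall>y. ip y v = ip (T y) x" for x
  proof (rule riesz_representation)
    show "bounded_linear (\<lambda>y. ip (T y) x)"
      by (rule bounded_linear_compose[OF bounded_linear_ip_left bl])
  qed (simp only: sc ip_scale_left)
  then have "\<exists>T'. \<forall>x y. ip y (T' x) = ip (T y) x" by (intro choice allI)
  then obtain T' where T'0: "ip y (T' x) = ip (T y) x" for x y by blast
  have T': "ip x (T y) = ip (T' x) y" for x y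
  proof -
    have "ip x (T y) = sconj (ip (T y) x)" by (rule ip_commute)
    also have "\<dots> = sconj (ip y (T' x))" by (simp only: T'0)
    also have "\<dots> = ip (T' x) y" by (rule ip_commute[symmetric])
    finally show ?thesis .
  qed
  obtain C where C: "C \<ge> 0" "norm (T x) \<le> norm x * C" for x
    using bounded_linear.nonneg_bounded[OF bl] by blast
  have "bounded_linear T'"
  proof (rule bounded_linear_intro[where K = C])
    show "T' (x + y) = T' x + T' y" for x y
      by (rule ip_eqI) (simp only: T'[symmetric] ip_add_left)
    show "T' (r *\<^sub>R x) = r *\<^sub>R T' x" for r x
      by (rule ip_eqI) (simp only: T'[symmetric] ip_scaleR_left)
    show "norm (T' x) \<le> norm x * C" for x
    proof (cases "T' x = 0")
      case False
      have "(norm (T' x))\<^sup>2 = rip x (T (T' x))" by (simp add: rip_self[symmetric] rip_def T')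
      also have "\<dots> \<le> norm x * (norm (T' x) * C)"
        using rip_le[of x "T (T' x)"] C(2)[of "T' x"]
        by (meson mult_left_mono norm_ge_zero order_trans)
      finally show ?thesis using False by (simp add: power2_eq_square)
    qed (simp add: C)
  qed
  then show ?thesis using T' by blast
qed

lemma closed_span_limit:
  assumes "\<And>n. f n \<in> module.span smul X" "f \<longlonglongrightarrow> x"
  shows "x \<in> closed_span smul X"
  using assms by (auto simp: closed_span_def closure_sequential)

lemma closed_spanE:
  assumes "x \<in> closed_span smul X"
  obtains f where "\<And>n. f n \<in> module.span smul X" "f \<longlonglongrightarrow> x"
  using assms unfolding closed_span_def closure_sequential by blast

lemma smul_closed_span:
  assumes "x \<in> closed_span smul X" shows "smul c x \<in> closed_span smul X"
proof -
  obtain f where f: "\<And>n. f n \<in> vs.span X" "f \<longlonglongrightarrow> x"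
    using closed_spanE[OF assms] by blast
  have "bounded_linear (smul c)"
  proof (rule bounded_linear_intro[where K = "norm c"])
    show "smul c (r *\<^sub>R x) = r *\<^sub>R smul c x" for r x
      by (simp only: scale_of_real[symmetric] vs.scale_left_commute)
  qed (simp_all add: vs.scale_right_distrib norm_smul)
  then have "(\<lambda>n. smul c (f n)) \<longlonglongrightarrow> smul c x" by (rule bounded_linear.tendsto) (rule f)
  moreover have "smul c (f n) \<in> vs.span X" for n using f(1) by (rule vs.span_scale)
  ultimately show ?thesis by (intro closed_span_limit)
qed

lemma closed_subspace_closed_span: "closed (closed_span smul X)" "subspace (closed_span smul X)"
proof -
  show "closed (closed_span smul X)" by (simp add: closed_span_def)
  show "subspace (closed_span smul X)"
  proof (rule subspaceI)
    show "0 \<in> closed_span smul X"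
      using closed_span_limit[of "\<lambda>_. 0"] vs.span_zero by simp
    show "x + y \<in> closed_span smul X"
      if x: "x \<in> closed_span smul X" and y: "y \<in> closed_span smul X" for x y
    proof -
      obtain f where f: "\<And>n. f n \<in> vs.span X" "f \<longlonglongrightarrow> x" using closed_spanE[OF x] by blast
      obtain g where g: "\<And>n. g n \<in> vs.span X" "g \<longlonglongrightarrow> y" using closed_spanE[OF y] by blast
      show ?thesis
        using vs.span_add[OF f(1) g(1)] tendsto_add[OF f(2) g(2)] by (rule closed_span_limit)
    qed
    show "c *\<^sub>R x \<in> closed_span smul X" if "x \<in> closed_span smul X" for c x
      using smul_closed_span[OF that, of "of_real c"] by (simp only: scale_of_real)
  qed
qed

text \<open>The projection of \<open>u\<close> onto the closed span differs from \<open>u\<close> by a vector orthogonal to \<open>X\<close>.\<close>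

lemma mem_closed_span_if_orthogonal:
  assumes "\<And>z. (\<forall>x\<in>X. ip x z = 0) \<Longrightarrow> ip u z = 0"
  shows "u \<in> closed_span smul X"
proof -
  let ?U = "closed_span smul X"
  obtain v where v: "v \<in> ?U" "\<forall>x\<in>?U. rip x v = rip x u"
    using representer_in_closed_subspace[OF bounded_linear_rip_left closed_subspace_closed_span]
    by blast
  have orth: "ip x (u - v) = 0" if "x \<in> ?U" for x
    using smul_closed_span[OF that] v(2)
    by (intro ip_eq_if_rip_eq) (simp add: rip_linear)
  have "X \<subseteq> ?U" unfolding closed_span_def by (meson closure_subset vs.span_superset order_trans)
  then have "ip u (u - v) = 0" using orth assms by blast
  then have "rip (u - v) (u - v) = 0"
    using orth[OF v(1)] unfolding rip_diff_left by (simp add: rip_def)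
  then show ?thesis using v(1) by (simp add: rip_self)
qed

text \<open>
  A diagonal subsequence makes the pairings with a countable dense set converge; boundedness
  extends this to all vectors, and the limit functional is represented by a vector.
\<close>

lemma weakly_convergent_subsequence:
  assumes bd: "\<And>n. norm (f n :: 'h) \<le> 1"
  shows "\<exists>r l. strict_mono (r :: nat \<Rightarrow> nat) \<and> (\<forall>x. (\<lambda>n. ip (f (r n)) x) \<longlonglongrightarrow> ip l x)"
proof -
  obtain D :: "'h set" where D: "countable D" "\<And>X. open X \<Longrightarrow> X \<noteq> {} \<Longrightarrow> \<exists>d\<in>D. d \<in> X"
    using countable_dense_exists by blast
  then have "D \<noteq> {}" by blast
  define d where "d = from_nat_into D"
  have ex_d: "\<exists>k. d k \<in> X" if "open X" "X \<noteq> {}" for X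
    using D(2)[OF that] from_nat_into_surj[OF D(1)] unfolding d_def by metis
  have rip_bd: "\<bar>rip (f n) x\<bar> \<le> norm x" for n x
  proof -
    have "\<bar>rip (f n) x\<bar> \<le> norm (ip (f n) x)" unfolding rip_def by (rule abs_re_part_le)
    also have "\<dots> \<le> norm (f n) * norm x" by (rule norm_ip_le)
    also have "\<dots> \<le> 1 * norm x" by (intro mult_right_mono bd) simp
    finally show ?thesis by simp
  qed
  let ?P = "\<lambda>k s. convergent (\<lambda>n. rip (f (s n)) (d k))"
  interpret subseqs ?P
  proof
    fix k and s :: "nat \<Rightarrow> nat"
    have "bounded (range (\<lambda>n. rip (f (s n)) (d k)))"
      using rip_bd by (intro boundedI[of _ "norm (d k)"]) auto
    then obtain l r where "strict_mono r" "((\<lambda>n. rip (f (s n)) (d k)) \<circ> r) \<longlonglongrightarrow> l"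
      using bounded_imp_convergent_subsequence by blast
    then show "\<exists>r'. strict_mono r' \<and> ?P k (s \<circ> r')"
      by (auto simp: convergent_def o_def)
  qed
  define r where "r = diagseq"
  have r: "strict_mono r" unfolding r_def by (rule subseq_diagseq)
  have conv_d: "?P k r" for k
  proof -
    have "?P k (diagseq \<circ> (+) (Suc k))"
    proof (rule diagseq_holds)
      fix r s :: "nat \<Rightarrow> nat" and n assume "strict_mono r" "?P n s"
      then show "?P n (s \<circ> r)"
        using LIMSEQ_subseq_LIMSEQ by (fastforce simp: convergent_def o_def)
    qed
    then have "convergent (\<lambda>n. rip (f (r (n + Suc k))) (d k))"
      by (simp add: r_def o_def add.commute)
    then show ?thesis using convergent_ignore_initial_segment[of "\<lambda>n. rip (f (r n)) (d k)" "Suc k"]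
      by simp
  qed
  have conv: "convergent (\<lambda>n. rip (f (r n)) x)" for x
  proof (rule Cauchy_convergent, rule CauchyI)
    fix e :: real assume e: "0 < e"
    obtain k where k: "d k \<in> ball x (e / 3)" using ex_d[of "ball x (e / 3)"] e by auto
    have near: "\<bar>rip (f n) x - rip (f n) (d k)\<bar> < e / 3" for n
      using rip_bd[of n "x - d k"] k by (simp add: rip_diff_right dist_norm)
    obtain N where N: "\<And>i j. i \<ge> N \<Longrightarrow> j \<ge> N \<Longrightarrow> \<bar>rip (f (r i)) (d k) - rip (f (r j)) (d k)\<bar> < e / 3"
      using CauchyD[OF convergent_Cauchy[OF conv_d], of "e / 3" k] e by auto
    have "norm (rip (f (r i)) x - rip (f (r j)) x) < e" if "i \<ge> N" "j \<ge> N" for i j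
      using N[OF that] near[of "r i"] near[of "r j"] by (simp only: real_norm_def)
    then show "\<exists>N. \<forall>i\<ge>N. \<forall>j\<ge>N. norm (rip (f (r i)) x - rip (f (r j)) x) < e" by blast
  qed
  define L where "L x = lim (\<lambda>n. rip (f (r n)) x)" for x
  have L: "(\<lambda>n. rip (f (r n)) x) \<longlonglongrightarrow> L x" for x
    unfolding L_def using conv convergent_LIMSEQ_iff by blast
  have "bounded_linear L"
  proof (rule bounded_linear_intro[where K = 1])
    show "L (x + y) = L x + L y" for x y
      using tendsto_add[OF L[of x] L[of y]] L[of "x + y"]
      by (simp add: rip_add_right) (rule LIMSEQ_unique)
    show "L (c *\<^sub>R x) = c *\<^sub>R L x" for c x
      using tendsto_mult_left[OF L[of x], of c] L[of "c *\<^sub>R x"]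
      by (simp add: rip_scaleR_right) (rule LIMSEQ_unique)
    show "norm (L x) \<le> norm x * 1" for x
      using tendsto_norm[OF L[of x]] rip_bd by (simp add: LIMSEQ_le_const2)
  qed
  then obtain l where l: "rip x l = L x" for x
    using representer_in_closed_subspace[of L UNIV] by auto
  have lim_rip: "(\<lambda>n. rip (f (r n) - l) x) \<longlonglongrightarrow> 0" for x
    using tendsto_diff[OF L[of x] tendsto_const[of "rip l x"]] l[of x]
    by (simp add: rip_diff_left rip_commute[of l])
  obtain i :: 'k where i: "\<And>z. norm z \<le> \<bar>re_part z\<bar> + \<bar>re_part (i * z)\<bar>"
    using norm_le_two_re_parts by blast
  have "(\<lambda>n. ip (f (r n)) x) \<longlonglongrightarrow> ip l x" for x
  proof (rule LIM_zero_cancel, rule Lim_null_comparison)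
    show "\<forall>\<^sub>F n in sequentially. norm (ip (f (r n)) x - ip l x)
        \<le> \<bar>rip (f (r n) - l) x\<bar> + \<bar>rip (f (r n) - l) (smul (sconj i) x)\<bar>"
    proof (intro always_eventually allI)
      fix n
      have "ip (f (r n) - l) x = ip (f (r n)) x - ip l x"
        using ip_add_left[of "f (r n) - l" l x] by simp
      then show "norm (ip (f (r n)) x - ip l x)
        \<le> \<bar>rip (f (r n) - l) x\<bar> + \<bar>rip (f (r n) - l) (smul (sconj i) x)\<bar>"
        using i[of "ip (f (r n) - l) x"] by (simp add: rip_def ip_scale_right)
    qed
    show "(\<lambda>n. \<bar>rip (f (r n) - l) x\<bar> + \<bar>rip (f (r n) - l) (smul (sconj i) x)\<bar>) \<longlonglongrightarrow> 0"
      using tendsto_add[OF tendsto_rabs_zero[OF lim_rip] tendsto_rabs_zero[OF lim_rip]] by simp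
  qed
  then show ?thesis using r by blast
qed

end


section \<open>Functions that escape to disjoint sets\<close>

text \<open>
  For a fixed \<open>i\<close> the integral of \<open>min (g n) (g i)\<close> tends to \<open>0\<close> by dominated convergence, so a
  subsequence can be chosen with all mutual overlaps as small as desired. Let \<open>D j\<close> be the set where
  the \<open>j\<close>-th function of the subsequence is strictly the largest. These sets are disjoint, and outside
  \<open>D j\<close> the \<open>j\<close>-th function is dominated by the sum of its overlaps with the others.
\<close>

lemma gliding_hump:
  fixes g :: "nat \<Rightarrow> 's \<Rightarrow> ennreal"
  assumes meas [measurable]: "\<And>n. g n \<in> borel_measurable M"
    and fin: "\<And>n. (\<integral>\<^sup>+s. g n s \<partial>M) < \<infinity>"
    and lim: "\<And>s. s \<in> space M \<Longrightarrow> (\<lambda>n. g n s) \<longlonglongrightarrow> 0"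
  shows "\<exists>r D. strict_mono r \<and> range D \<subseteq> sets M \<and> disjoint_family D \<and>
    (\<forall>j. (\<integral>\<^sup>+s\<in>space M - D j. g (r j) s \<partial>M) \<le> ennreal (2 * (1/2) ^ j))"
proof -
  define I where "I n i = (\<integral>\<^sup>+s. min (g n s) (g i s) \<partial>M)" for n i
  have I_lim: "(\<lambda>n. I n i) \<longlonglongrightarrow> 0" for i
  proof -
    have "(\<lambda>n. I n i) \<longlonglongrightarrow> (\<integral>\<^sup>+s. 0 \<partial>M)"
      unfolding I_def
    proof (rule nn_integral_dominated_convergence[where w = "g i"])
      show "AE s in M. (\<lambda>n. min (g n s) (g i s)) \<longlonglongrightarrow> 0"
        using tendsto_min[OF lim tendsto_const] by (intro AE_I2) simp
    qed (use fin in auto)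
    then show ?thesis by simp
  qed
  have step: "\<exists>n. n > k \<and> (\<forall>i\<le>k. I n i \<le> ennreal ((1/4) ^ Suc j))" for k j
  proof -
    have "\<forall>\<^sub>F n in sequentially. I n i < ennreal ((1/4) ^ Suc j)" for i
      using I_lim by (rule order_tendstoD) simp
    then have "\<forall>\<^sub>F n in sequentially. \<forall>i\<in>{..k}. I n i < ennreal ((1/4) ^ Suc j)"
      by (intro eventually_ball_finite) auto
    then have "\<forall>\<^sub>F n in sequentially. n > k \<and> (\<forall>i\<in>{..k}. I n i < ennreal ((1/4) ^ Suc j))"
      by (intro eventually_conj eventually_gt_at_top)
    then show ?thesis
      unfolding eventually_sequentially using less_imp_le by blast
  qed
  obtain r where r: "r j < r (Suc j)" "\<And>i. i \<le> r j \<Longrightarrow> I (r (Suc j)) i \<le> ennreal ((1/4) ^ Suc j)" for j :: nat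
  proof -
    have "\<exists>r. \<forall>j. True \<and> (r j < r (Suc j) \<and> (\<forall>i\<le>r j. I (r (Suc j)) i \<le> ennreal ((1/4) ^ Suc j)))"
      by (rule dependent_nat_choice) (use step in auto)
    then show ?thesis using that by blast
  qed
  have mono: "strict_mono r" using r(1) by (simp add: strict_mono_Suc_iff)
  have small_less: "I (r j) (r i) \<le> ennreal ((1/4) ^ j)" if ij: "i < j" for i j
  proof -
    obtain j' where j': "j = Suc j'" using ij by (cases j) auto
    then have "r i \<le> r j'" using ij mono by (simp add: strict_mono_less_eq)
    then show ?thesis using r(2) j' by simp
  qed
  \<comment> \<open>the choice of \<open>4\<^sup>-\<^sup>j\<close> makes the overlaps bounded by a product, hence summable in \<open>i\<close> with sum \<open>2 * 2\<^sup>-\<^sup>j\<close>\<close>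
  have le: "(1/4::real) ^ max i j \<le> (1/2) ^ i * (1/2) ^ j" for i j
  proof -
    have "(1/4::real) ^ max i j = (1/2) ^ max i j * (1/2) ^ max i j"
      by (simp flip: power_mult_distrib)
    also have "\<dots> \<le> (1/2) ^ i * (1/2) ^ j"
      by (intro mult_mono power_decreasing) auto
    finally show ?thesis .
  qed
  have small: "I (r j) (r i) \<le> ennreal ((1/2) ^ i * (1/2) ^ j)" if "i \<noteq> j" for i j
  proof -
    have "I (r j) (r i) \<le> ennreal ((1/4) ^ max i j)"
    proof (cases "i < j")
      case True
      then show ?thesis using small_less[of i j] by simp
    next
      case False
      moreover have "I (r j) (r i) = I (r i) (r j)" by (simp add: I_def min.commute)
      ultimately show ?thesis using small_less[of j i] that by simp
    qed
    also have "\<dots> \<le> ennreal ((1/2) ^ i * (1/2) ^ j)" using le by (rule ennreal_leI)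
    finally show ?thesis .
  qed
  define D where "D j = {s \<in> space M. \<forall>i. i \<noteq> j \<longrightarrow> g (r i) s < g (r j) s}" for j
  have D [measurable]: "D j \<in> sets M" for j unfolding D_def by measurable
  have disj: "disjoint_family D"
    unfolding disjoint_family_on_def D_def by (auto dest: less_asym)
  have "(\<integral>\<^sup>+s\<in>space M - D j. g (r j) s \<partial>M) \<le> ennreal (2 * (1/2) ^ j)" for j
  proof -
    define h where "h i s = (if i = j then 0 else min (g (r j) s) (g (r i) s))" for i s
    have [measurable]: "h i \<in> borel_measurable M" for i unfolding h_def by measurable
    have "(\<integral>\<^sup>+s\<in>space M - D j. g (r j) s \<partial>M) \<le> (\<integral>\<^sup>+s. (\<Sum>i. h i s) \<partial>M)"
    proof (rule nn_integral_mono)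
      fix s assume s: "s \<in> space M"
      show "g (r j) s * indicator (space M - D j) s \<le> (\<Sum>i. h i s)"
      proof (cases "s \<in> D j")
        case False
        then obtain i where i: "i \<noteq> j" "g (r j) s \<le> g (r i) s"
          using s unfolding D_def by (auto simp: not_less)
        then have "g (r j) s = h i s" by (simp add: h_def min_def)
        also have "\<dots> = (\<Sum>i\<in>{i}. h i s)" by simp
        also have "\<dots> \<le> (\<Sum>i. h i s)" by (intro sum_le_suminf) auto
        finally show ?thesis using False s by simp
      qed simp
    qed
    also have "\<dots> = (\<Sum>i. \<integral>\<^sup>+s. h i s \<partial>M)" by (rule nn_integral_suminf) simp
    also have "\<dots> \<le> (\<Sum>i. ennreal ((1/2) ^ i * (1/2) ^ j))"
    proof (rule suminf_le)
      show "(\<integral>\<^sup>+s. h i s \<partial>M) \<le> ennreal ((1/2) ^ i * (1/2) ^ j)" for i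
        using small[of i j] by (cases "i = j") (simp_all add: h_def I_def)
    qed auto
    also have "\<dots> = ennreal (\<Sum>i. (1/2) ^ i * (1/2) ^ j)"
      by (rule suminf_ennreal2) (auto intro!: summable_mult2 summable_geometric)
    also have "(\<Sum>i. (1/2::real) ^ i * (1/2) ^ j) = (\<Sum>i. (1/2) ^ i) * (1/2) ^ j"
      by (rule suminf_mult2[symmetric]) (simp add: summable_geometric)
    also have "\<dots> = 2 * (1/2) ^ j" by (simp add: suminf_geometric)
    finally show ?thesis .
  qed
  then show ?thesis using mono D disj by blast
qed


section \<open>Partial frame operators of Bessel families\<close>

lemma product_le_sum_of_squares: "a * b \<le> a\<^sup>2 + (b\<^sup>2 :: real)"
proof -
  have "0 \<le> (a - b)\<^sup>2 + a\<^sup>2 + b\<^sup>2" by simp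
  then show ?thesis by (simp add: power2_diff)
qed

lemma bounded_linear_if_quadratic_bound:
  fixes \<phi> :: "'a::real_normed_vector \<Rightarrow> 'b::real_normed_vector"
  assumes add: "\<And>x y. \<phi> (x + y) = \<phi> x + \<phi> y" and scale: "\<And>r x. \<phi> (r *\<^sub>R x) = r *\<^sub>R \<phi> x"
    and bound: "\<And>x. norm (\<phi> x) \<le> C * ((norm x)\<^sup>2 + c)"
  shows "bounded_linear \<phi>"
proof (rule bounded_linear_intro[OF add scale])
  fix x
  show "norm (\<phi> x) \<le> norm x * (C * (1 + c))"
  proof (cases "x = 0")
    case True
    then show ?thesis using scale[of 0 0] by simp
  next
    case False
    have "norm (\<phi> x) = norm x * norm (\<phi> (x /\<^sub>R norm x))"
      using False by (simp add: scale)
    also have "\<dots> \<le> norm x * (C * ((norm (x /\<^sub>R norm x))\<^sup>2 + c))"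
      by (intro mult_left_mono bound) simp
    finally show ?thesis using False by simp
  qed
qed

lemma set_integral_bounded_linear:
  assumes "bounded_linear T" "set_integrable M K f"
  shows "(LINT s:K|M. T (f s)) = T (LINT s:K|M. f s)"
proof -
  have "indicator K s *\<^sub>R T (f s) = T (indicator K s *\<^sub>R f s)" for s
    by (simp add: linear_scale[OF bounded_linear.linear[OF assms(1)]])
  then show ?thesis
    using integral_bounded_linear[OF assms(1)] assms(2)
    by (simp add: set_lebesgue_integral_def set_integrable_def)
qed

locale bessel_family = separable_hilbert smul ip
  for smul :: "'k::rc_scalar \<Rightarrow> 'h::{banach, second_countable_topology} \<Rightarrow> 'h"
    and ip :: "'h \<Rightarrow> 'h \<Rightarrow> 'k" +
  fixes M :: "'s measure" and F :: "'s \<Rightarrow> 'h" and B :: real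
  assumes weakly_measurable: "weakly_measurable ip M F"
    and B_nonneg: "0 \<le> B"
    and bessel_bound: "\<And>f. (\<integral>\<^sup>+s. ennreal ((norm (ip f (F s)))\<^sup>2) \<partial>M) \<le> ennreal (B * (norm f)\<^sup>2)"
begin

lemma coefficient_measurable [measurable]: "(\<lambda>s. ip f (F s)) \<in> borel_measurable M"
  using weakly_measurable by (simp add: weakly_measurable_def)

lemma square_integrable: "integrable M (\<lambda>s. (norm (ip f (F s)))\<^sup>2)"
proof (rule integrableI_nonneg)
  show "(\<integral>\<^sup>+s. ennreal ((norm (ip f (F s)))\<^sup>2) \<partial>M) < \<infinity>"
    using bessel_bound[of f] by (rule order_le_less_trans) simp
qed auto

definition energy :: "'s set \<Rightarrow> 'h \<Rightarrow> real"
  where "energy K f = (LINT s:K|M. (norm (ip f (F s)))\<^sup>2)"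

lemma square_set_integrable: "K \<in> sets M \<Longrightarrow> set_integrable M K (\<lambda>s. (norm (ip f (F s)))\<^sup>2)"
  unfolding set_integrable_def by (rule integrable_mult_indicator[OF _ square_integrable])

lemma nn_integral_eq_energy:
  assumes "K \<in> sets M"
  shows "(\<integral>\<^sup>+s\<in>K. ennreal ((norm (ip f (F s)))\<^sup>2) \<partial>M) = ennreal (energy K f)"
  unfolding energy_def
  by (rule nn_set_integral_eq_set_integral[OF square_integrable _ assms]) simp

lemma energy_nonneg: "0 \<le> energy K f"
  unfolding energy_def set_lebesgue_integral_def by (intro integral_nonneg_AE) auto

lemma energy_le:
  assumes "K \<in> sets M" shows "energy K f \<le> B * (norm f)\<^sup>2"
proof -
  have "ennreal (energy K f) \<le> (\<integral>\<^sup>+s. ennreal ((norm (ip f (F s)))\<^sup>2) \<partial>M)"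
    unfolding nn_integral_eq_energy[OF assms, symmetric]
    by (intro nn_integral_mono) (auto split: split_indicator)
  also note bessel_bound
  finally show ?thesis using B_nonneg by (simp add: ennreal_le_iff)
qed

lemma product_set_integrable:
  assumes "K \<in> sets M"
  shows "set_integrable M K (\<lambda>s. ip f (F s) * sconj (ip h (F s)))"
proof -
  have [measurable]: "(\<lambda>s. sconj (ip h (F s))) \<in> borel_measurable M"
    by (rule measurable_compose[OF coefficient_measurable borel_measurable_continuous_onI])
      (rule linear_continuous_on[OF bounded_linear_sconj])
  have "integrable M (\<lambda>s. ip f (F s) * sconj (ip h (F s)))"
  proof (rule Bochner_Integration.integrable_bound)
    show "integrable M (\<lambda>s. (norm (ip f (F s)))\<^sup>2 + (norm (ip h (F s)))\<^sup>2)"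
      by (intro Bochner_Integration.integrable_add square_integrable)
    show "AE s in M. norm (ip f (F s) * sconj (ip h (F s)))
        \<le> norm ((norm (ip f (F s)))\<^sup>2 + (norm (ip h (F s)))\<^sup>2)"
      using product_le_sum_of_squares by (simp add: norm_mult)
  qed measurable
  then show ?thesis unfolding set_integrable_def by (rule integrable_mult_indicator[OF assms])
qed

lemma norm_product_integral_le:
  assumes "K \<in> sets M"
  shows "norm (LINT s:K|M. ip f (F s) * sconj (ip h (F s))) \<le> B * ((norm f)\<^sup>2 + (norm h)\<^sup>2)"
proof -
  have "norm (LINT s:K|M. ip f (F s) * sconj (ip h (F s)))
      \<le> (LINT s:K|M. norm (ip f (F s) * sconj (ip h (F s))))"
    by (rule set_integral_norm_bound[OF product_set_integrable[OF assms]])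
  also have "\<dots> \<le> (LINT s:K|M. (norm (ip f (F s)))\<^sup>2 + (norm (ip h (F s)))\<^sup>2)"
  proof (rule set_integral_mono)
    show "norm (ip f (F s) * sconj (ip h (F s))) \<le> (norm (ip f (F s)))\<^sup>2 + (norm (ip h (F s)))\<^sup>2" for s
      using product_le_sum_of_squares by (simp add: norm_mult)
  qed (use product_set_integrable[OF assms] square_set_integrable[OF assms]
      in \<open>auto intro: set_integrable_norm set_integral_add\<close>)
  also have "\<dots> = energy K f + energy K h"
    unfolding energy_def by (intro set_integral_add square_set_integrable assms)
  also have "\<dots> \<le> B * ((norm f)\<^sup>2 + (norm h)\<^sup>2)"
    using energy_le[OF assms, of f] energy_le[OF assms, of h] by (simp add: distrib_left)
  finally show ?thesis .
qed

abbreviation S :: "'s set \<Rightarrow> 'h \<Rightarrow> 'h"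
  where "S \<equiv> partial_frame_op smul ip M F"

lemma integrand: "ip (smul (ip f (F s)) (F s)) h = ip f (F s) * sconj (ip h (F s))"
  unfolding ip_scale_left ip_commute[of "F s" h] ..

text \<open>
  The weak integral is the Riesz representer of the functional that integrates the product of
  coefficients; uniqueness turns the definite description in its definition into an existing object.
\<close>

lemma has_weak_integral_S:
  assumes K: "K \<in> sets M"
  shows "has_weak_integral ip M K (\<lambda>s. smul (ip f (F s)) (F s)) (S K f)"
proof -
  define \<phi> where "\<phi> h = (LINT s:K|M. ip h (F s) * sconj (ip f (F s)))" for h
  have "bounded_linear \<phi>"
  proof (rule bounded_linear_if_quadratic_bound)
    show "\<phi> (x + y) = \<phi> x + \<phi> y" for x y
      unfolding \<phi>_def ip_add_left distrib_right by (intro set_integral_add product_set_integrable K)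
    show "\<phi> (r *\<^sub>R x) = r *\<^sub>R \<phi> x" for r x
      unfolding \<phi>_def ip_scaleR_left mult_scaleR_left by (rule set_integral_scaleR_right)
    show "norm (\<phi> x) \<le> B * ((norm x)\<^sup>2 + (norm f)\<^sup>2)" for x
      unfolding \<phi>_def by (rule norm_product_integral_le[OF K])
  qed
  moreover have "\<phi> (smul c x) = c * \<phi> x" for c x
    unfolding \<phi>_def ip_scale_left mult.assoc by (rule set_integral_mult_right)
  ultimately obtain v where v: "ip x v = \<phi> x" for x using riesz_representation by blast
  have "ip v h = (LINT s:K|M. ip f (F s) * sconj (ip h (F s)))" for h
  proof -
    have "ip v h = sconj (\<phi> h)" by (simp only: ip_commute[of v h] v)
    also have "\<dots> = (LINT s:K|M. sconj (ip h (F s) * sconj (ip f (F s))))"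
      unfolding \<phi>_def
      by (rule set_integral_bounded_linear[OF bounded_linear_sconj product_set_integrable[OF K], symmetric])
    also have "\<dots> = (LINT s:K|M. ip f (F s) * sconj (ip h (F s)))"
      by (simp only: sconj_mult sconj_sconj mult.commute)
    finally show ?thesis .
  qed
  then have v: "has_weak_integral ip M K (\<lambda>s. smul (ip f (F s)) (F s)) v"
    unfolding has_weak_integral_def integrand using product_set_integrable[OF K] by blast
  show ?thesis
    unfolding partial_frame_op_def
  proof (rule theI[of _ v])
    show "w = v" if "has_weak_integral ip M K (\<lambda>s. smul (ip f (F s)) (F s)) w" for w
      using that v unfolding has_weak_integral_def by (intro ip_eqI) metis
  qed (rule v)
qed

lemma ip_S:
  assumes "K \<in> sets M"
  shows "ip (S K f) h = (LINT s:K|M. ip f (F s) * sconj (ip h (F s)))"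
  using has_weak_integral_S[OF assms] unfolding has_weak_integral_def integrand by blast

lemma ip_S_commute:
  assumes K: "K \<in> sets M" shows "ip (S K f) h = ip f (S K h)"
proof -
  have "ip f (S K h) = sconj (LINT s:K|M. ip h (F s) * sconj (ip f (F s)))"
    unfolding ip_S[OF K, symmetric] by (rule ip_commute)
  also have "\<dots> = (LINT s:K|M. sconj (ip h (F s) * sconj (ip f (F s))))"
    by (rule set_integral_bounded_linear[OF bounded_linear_sconj product_set_integrable[OF K], symmetric])
  also have "\<dots> = ip (S K f) h"
    by (simp only: ip_S[OF K] sconj_mult sconj_sconj mult.commute)
  finally show ?thesis by (rule sym)
qed

lemma rip_S_commute: "K \<in> sets M \<Longrightarrow> rip (S K f) h = rip f (S K h)"
  by (simp only: rip_def ip_S_commute)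

lemma rip_S_self:
  assumes K: "K \<in> sets M" shows "rip (S K f) f = energy K f"
  unfolding rip_def ip_S[OF K] energy_def
  by (subst set_integral_bounded_linear[OF bounded_linear_re_part product_set_integrable[OF K], symmetric])
    (simp only: re_part_mult_sconj)

lemma S_add: "K \<in> sets M \<Longrightarrow> S K (x + y) = S K x + S K y"
  by (rule ip_eqI) (simp only: ip_S_commute ip_add_left)

lemma S_scaleR: "K \<in> sets M \<Longrightarrow> S K (r *\<^sub>R x) = r *\<^sub>R S K x"
  by (rule ip_eqI) (simp only: ip_S_commute ip_scaleR_left)

text \<open>
  Cauchy-Schwarz for the form \<open>rip (S K x) y\<close>, kept in the additive form with a free weight \<open>t\<close>: it is
  positivity of the energy of \<open>t x - y\<close>.
\<close>

lemma two_rip_S_le: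
  assumes K: "K \<in> sets M" and t: "0 < t"
  shows "2 * rip (S K x) y \<le> t * energy K x + energy K y / t"
proof -
  have "energy K (t *\<^sub>R x + (- 1) *\<^sub>R y) = t\<^sup>2 * energy K x - 2 * t * rip (S K x) y + energy K y"
    unfolding rip_S_self[OF K, symmetric] S_add[OF K] S_scaleR[OF K] rip_linear
      rip_S_commute[OF K, of y x] rip_commute[of y]
    by (simp add: power2_eq_square algebra_simps)
  then have "2 * t * rip (S K x) y \<le> t\<^sup>2 * energy K x + energy K y"
    using energy_nonneg[of K "t *\<^sub>R x + (- 1) *\<^sub>R y"] by linarith
  then show ?thesis using t by (simp add: field_simps power2_eq_square)
qed

lemma norm_S_le:
  assumes K: "K \<in> sets M" shows "norm (S K x) \<le> (B + 1) * norm x"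
proof -
  define b where "b = B + 1"
  have b: "0 < b" "B \<le> b" using B_nonneg by (simp_all add: b_def)
  have le: "energy K y \<le> b * (norm y)\<^sup>2" for y
    using energy_le[OF K, of y] b(2) by (meson mult_right_mono order_trans zero_le_power2)
  have "2 * (norm (S K x))\<^sup>2 \<le> b * energy K x + energy K (S K x) / b"
    using two_rip_S_le[OF K b(1), of x "S K x"] by (simp add: rip_self)
  also have "\<dots> \<le> b * (b * (norm x)\<^sup>2) + b * (norm (S K x))\<^sup>2 / b"
    using b by (intro add_mono mult_left_mono divide_right_mono le) auto
  finally have "(norm (S K x))\<^sup>2 \<le> (b * norm x)\<^sup>2"
    using b by (simp add: power2_eq_square mult_ac)
  then have "norm (S K x) \<le> b * norm x" by (rule power2_le_imp_le) (use b in simp)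
  then show ?thesis by (simp only: b_def)
qed

lemma bounded_linear_S:
  assumes K: "K \<in> sets M" shows "bounded_linear (S K)"
  using norm_S_le[OF K]
  by (intro bounded_linear_intro[where K = "B + 1"] S_add[OF K] S_scaleR[OF K])
    (simp add: mult.commute)

lemma energy_split:
  assumes K: "K \<in> sets M"
  shows "energy K f + energy (space M - K) f = energy (space M) f"
proof -
  have "K \<union> (space M - K) = space M" using sets.sets_into_space[OF K] by blast
  then show ?thesis
    unfolding energy_def
    by (subst set_integral_Un[symmetric]) (use K square_set_integrable in auto)
qed

lemma S_split:
  assumes K: "K \<in> sets M"
  shows "S K f + S (space M - K) f = S (space M) f"
proof (rule ip_eqI)
  fix h
  have "K \<union> (space M - K) = space M" using sets.sets_into_space[OF K] by blast
  then have "ip (S (space M) f) h = (LINT s:K \<union> (space M - K)|M. ip f (F s) * sconj (ip h (F s)))"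
    by (simp add: ip_S)
  also have "\<dots> = ip (S K f) h + ip (S (space M - K) f) h"
    by (subst set_integral_Un) (use K product_set_integrable in \<open>auto simp: ip_S\<close>)
  finally show "ip (S K f + S (space M - K) f) h = ip (S (space M) f) h"
    unfolding ip_add_left by (rule sym)
qed

lemma S_mem_closed_span:
  assumes K: "K \<in> sets M" shows "S K f \<in> closed_span smul (F ` K)"
proof (rule mem_closed_span_if_orthogonal)
  fix z assume z: "\<forall>x\<in>F ` K. ip x z = 0"
  have "ip z (F s) = 0" if "s \<in> K" for s
  proof -
    have "ip z (F s) = sconj (ip (F s) z)" by (rule ip_commute)
    then show ?thesis using z that by simp
  qed
  then have "ip (S K f) z = (LINT s:K|M. 0)"
    unfolding ip_S[OF K] by (intro set_lebesgue_integral_cong K) auto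
  then show "ip (S K f) z = 0" by simp
qed

text \<open>
  Let \<open>a n\<close> be the energy of \<open>T\<^sup>n g\<close>, which is \<open>[T\<^sup>2\<^sup>n g, g]\<close> for the form \<open>[x, y] = rip (S K x) y\<close>,
  as \<open>T\<close> is symmetric for it. Positivity of the form gives \<open>2 (a n - a 0) \<le> a (2n) - a 0\<close>. If
  \<open>a 1 > a 0\<close>, then \<open>a\<close> is unbounded along the powers of \<open>2\<close>, while the contraction property bounds it.
\<close>

lemma energy_contraction:
  assumes K: "K \<in> sets M"
    and sym: "\<And>x y. rip (T x) y = rip x (T y)"
    and comm: "\<And>x. S K (T x) = T (S K x)"
    and contr: "\<And>x. norm (T x) \<le> norm x"
  shows "energy K (T g) \<le> energy K g"
proof (rule ccontr)
  assume neg: "\<not> energy K (T g) \<le> energy K g"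
  define a where "a n = energy K ((T ^^ n) g)" for n
  have sym_pow: "rip ((T ^^ n) x) y = rip x ((T ^^ n) y)" for n x y
    by (induction n arbitrary: x y) (simp_all add: sym funpow_swap1)
  have comm_pow: "S K ((T ^^ n) x) = (T ^^ n) (S K x)" for n x
    by (induction n) (simp_all add: comm)
  have "2 * a n \<le> a (n + n) + a 0" for n
  proof -
    have "a n = rip (S K ((T ^^ n) g)) ((T ^^ n) g)"
      unfolding a_def by (rule rip_S_self[OF K, symmetric])
    also have "\<dots> = rip ((T ^^ n) (S K ((T ^^ n) g))) g" by (rule sym_pow[symmetric])
    also have "\<dots> = rip (S K ((T ^^ (n + n)) g)) g" by (simp only: comm_pow funpow_add o_apply)
    finally show ?thesis
      using two_rip_S_le[OF K, of 1 "(T ^^ (n + n)) g" g] by (simp add: a_def)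
  qed
  then have double: "2 * (a n - a 0) \<le> a (2 * n) - a 0" for n
    by (simp add: mult_2[symmetric] algebra_simps)
  have grow: "2 ^ k * (a 1 - a 0) \<le> a (2 ^ k) - a 0" for k
  proof (induction k)
    case (Suc k)
    then have "2 * (2 ^ k * (a 1 - a 0)) \<le> 2 * (a (2 ^ k) - a 0)" by simp
    also have "\<dots> \<le> a (2 ^ Suc k) - a 0" using double[of "2 ^ k"] by simp
    finally show ?case by simp
  qed simp
  have "norm ((T ^^ n) g) \<le> norm g" for n
    by (induction n) (auto intro: order_trans[OF contr])
  then have "(norm ((T ^^ n) g))\<^sup>2 \<le> (norm g)\<^sup>2" for n by (intro power_mono) auto
  then have bound: "a n \<le> B * (norm g)\<^sup>2" for n
    unfolding a_def using energy_le[OF K] B_nonneg by (meson mult_left_mono order_trans)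
  have pos: "0 < a 1 - a 0" using neg by (simp add: a_def)
  obtain k where "B * (norm g)\<^sup>2 / (a 1 - a 0) < 2 ^ k"
    using real_arch_pow[of 2] by auto
  then have "B * (norm g)\<^sup>2 < 2 ^ k * (a 1 - a 0)" using pos by (simp add: field_simps)
  also have "\<dots> \<le> a (2 ^ k)" using grow[of k] energy_nonneg[of K g] by (simp add: a_def)
  finally show False using bound[of "2 ^ k"] by linarith
qed

end


section \<open>Frame operators and the canonical dual\<close>

locale frame_family = bessel_family smul ip M F B
  for smul :: "'k::rc_scalar \<Rightarrow> 'h::{banach, second_countable_topology} \<Rightarrow> 'h"
    and ip :: "'h \<Rightarrow> 'h \<Rightarrow> 'k" and M :: "'s measure" and F :: "'s \<Rightarrow> 'h" and B :: real +
  fixes A :: real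
  assumes A_pos: "0 < A"
    and frame_lower: "\<And>f. A * (norm f)\<^sup>2 \<le> energy (space M) f"
begin

abbreviation SF :: "'h \<Rightarrow> 'h"
  where "SF \<equiv> frame_op smul ip M F"

lemma norm_SF_ge: "A * norm f \<le> norm (SF f)"
proof (cases "f = 0")
  case False
  have "A * (norm f)\<^sup>2 \<le> rip (SF f) f"
    using frame_lower[of f] by (simp add: frame_op_def rip_S_self)
  also have "\<dots> \<le> norm (SF f) * norm f" by (rule rip_le)
  finally show ?thesis using False by (simp add: power2_eq_square)
qed simp

lemma bounded_linear_SF: "bounded_linear SF"
  unfolding frame_op_def by (rule bounded_linear_S) simp

lemma ip_SF_commute: "ip (SF f) h = ip f (SF h)"
  unfolding frame_op_def by (rule ip_S_commute) simp

text \<open>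
  The frame operator is bounded below, so it is injective with closed range; a vector orthogonal to
  the range has energy \<open>0\<close> and vanishes.
\<close>

lemma bij_SF: "bij SF"
proof (rule bijI)
  interpret SF: bounded_linear SF by (rule bounded_linear_SF)
  show "inj SF"
  proof (rule injI)
    fix x y assume "SF x = SF y"
    then have "A * norm (x - y) \<le> 0" using norm_SF_ge[of "x - y"] by (simp add: SF.diff)
    then show "x = y" using A_pos by (simp add: mult_le_0_iff)
  qed
  have "complete (range SF)"
    using A_pos subspace_UNIV bounded_linear_SF norm_SF_ge complete_UNIV
    by (intro complete_isometric_image) auto
  then have closed: "closed (range SF)" by (rule complete_imp_closed)
  have subspace: "subspace (range SF)"
    by (rule linear_subspace_image[OF SF.linear subspace_UNIV])
  show "surj SF"
  proof -
    have "\<exists>x. SF x = f" for f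
    proof -
      obtain v where v: "v \<in> range SF" "\<forall>x\<in>range SF. rip x v = rip x f"
        using representer_in_closed_subspace[OF bounded_linear_rip_left closed subspace, of f] by blast
      have "rip (SF (f - v)) (f - v) = 0" using v(2) by (simp add: rip_diff_right)
      then have "A * (norm (f - v))\<^sup>2 \<le> 0"
        using frame_lower[of "f - v"] by (simp add: frame_op_def rip_S_self)
      then have "f = v" using A_pos by (simp add: mult_le_0_iff)
      then show ?thesis using v(1) by blast
    qed
    then show ?thesis by (metis surj_def)
  qed
qed

lemma SF_inv [simp]: "SF (inv SF f) = f"
  by (rule surj_f_inv_f[OF bij_is_surj[OF bij_SF]])

lemma ip_inv_SF_commute: "ip (inv SF f) h = ip f (inv SF h)"
  using ip_SF_commute[of "inv SF f" "inv SF h"] by simp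

lemma norm_inv_SF_le: "norm (inv SF f) \<le> norm f / A"
  using norm_SF_ge[of "inv SF f"] A_pos by (simp add: field_simps)

text \<open>The lower bound of each weaving comes from \<open>energy_contraction\<close> for \<open>SF\<close>, applied to \<open>inv SF f\<close>.\<close>

lemma woven_canonical_dual:
  assumes ge: "operator_ge ip (inv SF) id"
    and comm: "\<And>K. K \<in> sets M \<Longrightarrow> SF \<circ> S K = S K \<circ> SF"
  shows "continuous_woven ip M F (\<lambda>s. inv SF (F s))"
proof -
  have contr: "norm (SF x) \<le> norm x" for x
  proof (cases "SF x = 0")
    case False
    obtain r where "0 \<le> r" "ip (inv SF (SF x) - id (SF x)) (SF x) = of_real r"
      using ge unfolding operator_ge_def by blast
    then have "0 \<le> rip (inv SF (SF x) - SF x) (SF x)" by (simp add: rip_def)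
    moreover have "inv SF (SF x) = x" using bij_SF by (simp add: bij_is_inj)
    ultimately have "(norm (SF x))\<^sup>2 \<le> rip x (SF x)" by (simp add: rip_diff_left rip_self)
    also have "\<dots> \<le> norm x * norm (SF x)" by (rule rip_le)
    finally show ?thesis using False by (simp add: power2_eq_square)
  qed simp
  have dual: "(\<integral>\<^sup>+s\<in>K. ennreal ((norm (ip f (inv SF (F s))))\<^sup>2) \<partial>M) = ennreal (energy K (inv SF f))"
    if "K \<in> sets M" for K f
    unfolding nn_integral_eq_energy[OF that, symmetric] ip_inv_SF_commute ..
  let ?B = "max A (B + B / A\<^sup>2)"
  have "A * (norm f)\<^sup>2 \<le> energy K f + energy (space M - K) (inv SF f)" (is ?lower)
    and "energy K f + energy (space M - K) (inv SF f) \<le> ?B * (norm f)\<^sup>2" (is ?upper)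
    if K: "K \<in> sets M" for K f
  proof -
    have K': "space M - K \<in> sets M" using K by simp
    have "energy (space M - K) (SF (inv SF f)) \<le> energy (space M - K) (inv SF f)"
    proof (rule energy_contraction[OF K' _ _ contr])
      show "rip (SF x) y = rip x (SF y)" for x y by (simp only: rip_def ip_SF_commute)
      show "S (space M - K) (SF x) = SF (S (space M - K) x)" for x
        using comm[OF K'] by (metis comp_apply)
    qed
    then show ?lower using frame_lower[of f] energy_split[OF K, of f] by simp
    have "energy (space M - K) (inv SF f) \<le> B * (norm (inv SF f))\<^sup>2" by (rule energy_le[OF K'])
    also have "\<dots> \<le> B * (norm f / A)\<^sup>2"
      using norm_inv_SF_le B_nonneg by (intro mult_left_mono power_mono) auto
    finally have "energy K f + energy (space M - K) (inv SF f) \<le> (B + B / A\<^sup>2) * (norm f)\<^sup>2"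
      using energy_le[OF K, of f] by (simp add: distrib_right power_divide)
    also have "\<dots> \<le> ?B * (norm f)\<^sup>2" by (intro mult_right_mono) auto
    finally show ?upper .
  qed note bounds = this
  show ?thesis
    unfolding continuous_woven_def Let_def
  proof (intro conjI exI ballI allI)
    show "weakly_measurable ip M F" by (rule weakly_measurable)
    show "weakly_measurable ip M (\<lambda>s. inv SF (F s))"
      unfolding weakly_measurable_def ip_inv_SF_commute[symmetric] by simp
    show "0 < A" "A \<le> ?B" using A_pos by auto
    fix K f assume K: "K \<in> sets M"
    then have K': "space M - K \<in> sets M" by simp
    show "ennreal (A * (norm f)\<^sup>2) \<le> (\<integral>\<^sup>+s\<in>K. ennreal ((norm (ip f (F s)))\<^sup>2) \<partial>M)
        + (\<integral>\<^sup>+s\<in>space M - K. ennreal ((norm (ip f (inv SF (F s))))\<^sup>2) \<partial>M)"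
      unfolding nn_integral_eq_energy[OF K] dual[OF K']
      using bounds(1)[OF K, of f] energy_nonneg by (simp flip: ennreal_plus add: ennreal_leI)
    show "(\<integral>\<^sup>+s\<in>K. ennreal ((norm (ip f (F s)))\<^sup>2) \<partial>M)
        + (\<integral>\<^sup>+s\<in>space M - K. ennreal ((norm (ip f (inv SF (F s))))\<^sup>2) \<partial>M)
        \<le> ennreal (?B * (norm f)\<^sup>2)"
      unfolding nn_integral_eq_energy[OF K] dual[OF K']
      using bounds(2)[OF K, of f] energy_nonneg by (simp flip: ennreal_plus add: ennreal_leI)
  qed
qed


section \<open>Perturbing a single weaving\<close>

text \<open>
  Here \<open>F\<close> stands for the weaving, and the conclusion bounds the energy of the family that is \<open>T1 F\<close> on
  \<open>K\<close> and \<open>T2 F\<close> off \<open>K\<close>. With \<open>h0 = SF\<^sup>-\<^sup>1 T1\<^sup>-\<^sup>1 f\<close>, the two parts \<open>u\<close> and \<open>v\<close> of the frame expansion of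
  \<open>T1\<^sup>-\<^sup>1 f\<close> are \<open>S K h0\<close> and \<open>S (space M - K) h0\<close>. The vector \<open>T1 u + T2 v = f - (T1 - T2) v\<close> pairs with
  \<open>f\<close> to at least \<open>\<theta> \<parallel>f\<parallel>\<^sup>2\<close>; conversely, \<open>two_rip_S_le\<close> bounds twice this
  pairing by \<open>1 / t\<close> times the energy in question plus \<open>t C \<parallel>f\<parallel>\<^sup>2\<close>, and \<open>t\<close> is so small that the
  last term is absorbed.
\<close>

lemma perturbed_energy_lower_bound:
  assumes K: "K \<in> sets M"
    and adj1: "\<And>x y. ip x (T1 y) = ip (T1' x) y" and adj2: "\<And>x y. ip x (T2 y) = ip (T2' x) y"
    and T1: "bounded_invertible_operator smul T1" and T2: "bounded_operator smul T2"
    and sep: "\<And>u v. u \<in> closed_span smul (F ` K) \<Longrightarrow> v \<in> closed_span smul (F ` (space M - K)) \<Longrightarrow>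
      c * norm v \<le> norm (u + v)"
    and c: "onorm (\<lambda>x. T1 x - T2 x) * onorm (inv T1) < c"
  shows "\<exists>a>0. \<forall>f. a * (norm f)\<^sup>2 \<le> energy K (T1' f) + energy (space M - K) (T2' f)"
proof -
  have bl: "bounded_linear T1" "bounded_linear T2" "bounded_linear (inv T1)" and "bij T1"
    using T1 T2 by (auto simp: bounded_invertible_operator_def bounded_operator_def)
  define d where "d = onorm (\<lambda>x. T1 x - T2 x)"
  define N where "N = onorm (inv T1)"
  have bl_diff: "bounded_linear (\<lambda>x. T1 x - T2 x)" by (intro bounded_linear_sub bl)
  have d: "0 \<le> d" "norm (T1 x - T2 x) \<le> d * norm x" for x
    unfolding d_def using onorm_pos_le[OF bl_diff] onorm[OF bl_diff] by auto
  have N: "0 \<le> N" "norm (inv T1 x) \<le> N * norm x" for x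
    unfolding N_def using onorm_pos_le[OF bl(3)] onorm[OF bl(3)] by auto
  have "0 < c" using c mult_nonneg_nonneg[OF d(1) N(1)] unfolding d_def N_def by linarith
  define \<theta> where "\<theta> = 1 - d * N / c"
  have \<theta>: "0 < \<theta>" using c \<open>0 < c\<close> by (simp add: \<theta>_def d_def N_def)
  define C where "C = B * (N / A)\<^sup>2"
  have C: "0 \<le> C" using B_nonneg by (simp add: C_def)
  define t where "t = \<theta> / (C + 1)"
  have t: "0 < t" "t * C \<le> \<theta>" using \<theta> C by (simp_all add: t_def field_simps)
  have K': "space M - K \<in> sets M" using K by simp
  have "t * \<theta> * (norm f)\<^sup>2 \<le> energy K (T1' f) + energy (space M - K) (T2' f)" for f
  proof -
    define h where "h = inv T1 f"
    define h0 where "h0 = inv SF h"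
    define u where "u = S K h0"
    define v where "v = S (space M - K) h0"
    have uv: "u + v = h"
      using S_split[OF K, of h0] SF_inv[of h] by (simp only: u_def v_def h0_def frame_op_def)
    have h: "norm h \<le> N * norm f" unfolding h_def by (rule N)
    have "c * norm v \<le> norm (u + v)"
      unfolding u_def v_def by (rule sep; rule S_mem_closed_span) (fact K K')+
    then have v: "norm v \<le> N * norm f / c" using h \<open>0 < c\<close> by (simp add: uv field_simps)
    have "T1 h = f" unfolding h_def by (rule surj_f_inv_f[OF bij_is_surj[OF \<open>bij T1\<close>]])
    then have T: "T1 u + T2 v = f - (T1 v - T2 v)"
      unfolding uv[symmetric] linear_add[OF bounded_linear.linear[OF bl(1)]]
      by (simp add: algebra_simps)
    have "rip f (T1 v - T2 v) \<le> norm f * norm (T1 v - T2 v)" by (rule rip_le)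
    also have "\<dots> \<le> norm f * (d * (N * norm f / c))"
      using d v by (intro mult_left_mono order_trans[OF d(2)]) auto
    finally have "\<theta> * (norm f)\<^sup>2 \<le> rip f (T1 u + T2 v)"
      unfolding T rip_diff_right rip_self by (simp add: \<theta>_def power2_eq_square algebra_simps)
    also have "\<dots> = rip (S K h0) (T1' f) + rip (S (space M - K) h0) (T2' f)"
      unfolding rip_add_right u_def[symmetric] v_def[symmetric] rip_commute[of u] rip_commute[of v]
      by (simp only: rip_def adj1 adj2)
    finally have "2 * (\<theta> * (norm f)\<^sup>2) \<le> t * energy K h0 + energy K (T1' f) / t
        + (t * energy (space M - K) h0 + energy (space M - K) (T2' f) / t)"
      using two_rip_S_le[OF K t(1), of h0 "T1' f"] two_rip_S_le[OF K' t(1), of h0 "T2' f"] by linarith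
    also have "\<dots> = t * energy (space M) h0 + (energy K (T1' f) + energy (space M - K) (T2' f)) / t"
      unfolding energy_split[OF K, symmetric] by (simp add: distrib_left add_divide_distrib)
    also have "t * energy (space M) h0 \<le> \<theta> * (norm f)\<^sup>2"
    proof -
      have "norm h0 \<le> N / A * norm f"
        using norm_inv_SF_le[of h] h A_pos unfolding h0_def by (simp add: field_simps)
      then have "(norm h0)\<^sup>2 \<le> (N / A * norm f)\<^sup>2" by (intro power_mono) auto
      then have "B * (norm h0)\<^sup>2 \<le> C * (norm f)\<^sup>2"
        using B_nonneg unfolding C_def power_mult_distrib mult.assoc by (intro mult_left_mono)
      then have "energy (space M) h0 \<le> C * (norm f)\<^sup>2"
        using energy_le[of "space M" h0] by simp
      then have "t * energy (space M) h0 \<le> t * C * (norm f)\<^sup>2" using t(1) by (simp add: mult.assoc)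
      also have "\<dots> \<le> \<theta> * (norm f)\<^sup>2" by (intro mult_right_mono t) simp
      finally show ?thesis .
    qed
    finally have "\<theta> * (norm f)\<^sup>2 \<le> (energy K (T1' f) + energy (space M - K) (T2' f)) / t" by simp
    then show ?thesis using t(1) by (simp add: field_simps)
  qed
  then show ?thesis using t(1) \<theta> by (intro exI[of _ "t * \<theta>"]) auto
qed

end


section \<open>From bounds for each weaving to a uniform bound\<close>

definition weave :: "'s set \<Rightarrow> ('s \<Rightarrow> 'h) \<Rightarrow> ('s \<Rightarrow> 'h) \<Rightarrow> 's \<Rightarrow> 'h"
  where "weave K F G s = (if s \<in> K then F s else G s)"

lemma nn_integral_weave:
  assumes [measurable]: "K \<in> sets M" "a \<in> borel_measurable M" "b \<in> borel_measurable M"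
  shows "(\<integral>\<^sup>+s. (if s \<in> K then a s else b s) \<partial>M)
    = (\<integral>\<^sup>+s\<in>K. a s \<partial>M) + (\<integral>\<^sup>+s\<in>space M - K. b s \<partial>M)"
proof -
  have "(\<integral>\<^sup>+s. (if s \<in> K then a s else b s) \<partial>M)
      = (\<integral>\<^sup>+s. a s * indicator K s + b s * indicator (space M - K) s \<partial>M)"
    by (rule nn_integral_cong) (simp split: split_indicator)
  also have "\<dots> = (\<integral>\<^sup>+s\<in>K. a s \<partial>M) + (\<integral>\<^sup>+s\<in>space M - K. b s \<partial>M)"
    by (rule nn_integral_add) simp_all
  finally show ?thesis .
qed

context separable_hilbert
begin

definition weave_energy :: "'s measure \<Rightarrow> ('s \<Rightarrow> 'h) \<Rightarrow> ('s \<Rightarrow> 'h) \<Rightarrow> 's set \<Rightarrow> 'h \<Rightarrow> ennreal"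
  where "weave_energy M F G K f = (\<integral>\<^sup>+s\<in>K. ennreal ((norm (ip f (F s)))\<^sup>2) \<partial>M)
    + (\<integral>\<^sup>+s\<in>space M - K. ennreal ((norm (ip f (G s)))\<^sup>2) \<partial>M)"

lemma weave_energy_eq:
  assumes K: "K \<in> sets M" and F: "weakly_measurable ip M F" and G: "weakly_measurable ip M G"
  shows "weave_energy M F G K f = (\<integral>\<^sup>+s. ennreal ((norm (ip f (weave K F G s)))\<^sup>2) \<partial>M)"
proof -
  have [measurable]: "(\<lambda>s. ip f (F s)) \<in> borel_measurable M" "(\<lambda>s. ip f (G s)) \<in> borel_measurable M"
    using F G by (simp_all add: weakly_measurable_def)
  have "weave_energy M F G K f = (\<integral>\<^sup>+s. (if s \<in> K then ennreal ((norm (ip f (F s)))\<^sup>2)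
      else ennreal ((norm (ip f (G s)))\<^sup>2)) \<partial>M)"
    unfolding weave_energy_def by (rule nn_integral_weave[symmetric]) (use K in simp_all)
  also have "\<dots> = (\<integral>\<^sup>+s. ennreal ((norm (ip f (weave K F G s)))\<^sup>2) \<partial>M)"
    by (rule nn_integral_cong) (simp add: weave_def)
  finally show ?thesis .
qed

lemma weakly_measurable_weave:
  assumes "K \<in> sets M" "weakly_measurable ip M F" "weakly_measurable ip M G"
  shows "weakly_measurable ip M (weave K F G)"
  unfolding weakly_measurable_def
proof
  fix f
  have [measurable]: "(\<lambda>s. ip f (F s)) \<in> borel_measurable M" "(\<lambda>s. ip f (G s)) \<in> borel_measurable M"
      "K \<in> sets M"
    using assms by (simp_all add: weakly_measurable_def)
  have "(\<lambda>s. if s \<in> K then ip f (F s) else ip f (G s)) \<in> borel_measurable M" by measurable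
  then show "(\<lambda>s. ip f (weave K F G s)) \<in> borel_measurable M"
    by (simp add: weave_def if_distrib[of "ip f"])
qed

lemma continuous_woven_altdef:
  "continuous_woven ip M F G \<longleftrightarrow> weakly_measurable ip M F \<and> weakly_measurable ip M G \<and>
    (\<exists>A B. 0 < A \<and> A \<le> B \<and> (\<forall>K\<in>sets M. \<forall>f. ennreal (A * (norm f)\<^sup>2) \<le> weave_energy M F G K f
      \<and> weave_energy M F G K f \<le> ennreal (B * (norm f)\<^sup>2)))"
  unfolding continuous_woven_def weave_energy_def Let_def ..

lemma frame_family_if_frame:
  assumes "continuous_frame ip M F"
  shows "\<exists>B A. frame_family smul ip M F B A"
proof -
  obtain A B where wm: "weakly_measurable ip M F" and A: "0 < A" "A \<le> B"
    and bounds: "\<And>f. ennreal (A * (norm f)\<^sup>2) \<le> (\<integral>\<^sup>+s. ennreal ((norm (ip f (F s)))\<^sup>2) \<partial>M)"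
      "\<And>f. (\<integral>\<^sup>+s. ennreal ((norm (ip f (F s)))\<^sup>2) \<partial>M) \<le> ennreal (B * (norm f)\<^sup>2)"
    using assms unfolding continuous_frame_def by blast
  interpret bessel_family smul ip M F B
    by unfold_locales (use wm A bounds in auto)
  have "frame_family smul ip M F B A"
  proof unfold_locales
    show "A * (norm f)\<^sup>2 \<le> energy (space M) f" for f
    proof -
      have "ennreal (A * (norm f)\<^sup>2) \<le> ennreal (energy (space M) f)"
        using bounds(1)[of f] nn_integral_eq_energy[of "space M" f] by simp
      then show ?thesis by (simp add: ennreal_le_iff energy_nonneg)
    qed
  qed (fact A)
  then show ?thesis by blast
qed

text \<open>
  The smallest energy of \<open>f\<close> among all weavings is the integral of \<open>m f\<close>, the pointwise minimum of the
  squared coefficients \<open>a f\<close> and \<open>b f\<close>; it is attained by a weaving that depends on \<open>f\<close>. If it has no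
  uniform lower bound on the unit sphere, a weakly null sequence of unit vectors witnesses this, and
  gluing its optimal weavings along the disjoint sets of \<open>gliding_hump\<close> gives a weaving \<open>W\<close> that has
  no lower bound either.
\<close>

lemma woven_if_every_weaving_bounded_below:
  assumes F: "bessel_family smul ip M F B1" and G: "bessel_family smul ip M G B2"
    and lower: "\<And>K. K \<in> sets M \<Longrightarrow> \<exists>a>0. \<forall>f. ennreal (a * (norm f)\<^sup>2) \<le> weave_energy M F G K f"
  shows "continuous_woven ip M F G"
proof -
  interpret F: bessel_family smul ip M F B1 by (rule F)
  interpret G: bessel_family smul ip M G B2 by (rule G)
  define a where "a f s = ennreal ((norm (ip f (F s)))\<^sup>2)" for f s
  define b where "b f s = ennreal ((norm (ip f (G s)))\<^sup>2)" for f s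
  have [measurable]: "a f \<in> borel_measurable M" "b f \<in> borel_measurable M" for f
    unfolding a_def b_def by measurable
  have we: "weave_energy M F G K f = (\<integral>\<^sup>+s. (if s \<in> K then a f s else b f s) \<partial>M)"
    if "K \<in> sets M" for K f
    unfolding weave_energy_def a_def b_def by (rule nn_integral_weave[symmetric]) (use that in simp_all)
  have int_a: "(\<integral>\<^sup>+s. a f s \<partial>M) \<le> ennreal (B1 * (norm f)\<^sup>2)" for f
    unfolding a_def by (rule F.bessel_bound)
  have int_b: "(\<integral>\<^sup>+s. b f s \<partial>M) \<le> ennreal (B2 * (norm f)\<^sup>2)" for f
    unfolding b_def by (rule G.bessel_bound)
  have upper: "weave_energy M F G K f \<le> ennreal ((B1 + B2) * (norm f)\<^sup>2)" if K: "K \<in> sets M" for K f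
  proof -
    have "weave_energy M F G K f \<le> (\<integral>\<^sup>+s. a f s + b f s \<partial>M)"
      unfolding we[OF K] by (rule nn_integral_mono) simp
    also have "\<dots> = (\<integral>\<^sup>+s. a f s \<partial>M) + (\<integral>\<^sup>+s. b f s \<partial>M)" by (rule nn_integral_add) simp_all
    also have "\<dots> \<le> ennreal (B1 * (norm f)\<^sup>2) + ennreal (B2 * (norm f)\<^sup>2)"
      by (intro add_mono int_a int_b)
    also have "\<dots> = ennreal ((B1 + B2) * (norm f)\<^sup>2)"
      using F.B_nonneg G.B_nonneg by (simp add: distrib_right flip: ennreal_plus)
    finally show ?thesis .
  qed
  have "\<exists>A>0. \<forall>K\<in>sets M. \<forall>f. ennreal (A * (norm f)\<^sup>2) \<le> weave_energy M F G K f"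
  proof (rule ccontr)
    assume neg: "\<not> ?thesis"
    have "\<exists>K f. K \<in> sets M \<and> norm f = 1 \<and> weave_energy M F G K f \<le> ennreal (1 / real (Suc n))" for n
    proof -
      have "0 < 1 / real (Suc n)" by simp
      then obtain K g where K: "K \<in> sets M"
        and less: "weave_energy M F G K g < ennreal (1 / real (Suc n) * (norm g)\<^sup>2)"
        using neg by (meson not_le)
      have g: "g \<noteq> 0"
      proof
        assume "g = 0"
        with less show False by simp
      qed
      define f where "f = g /\<^sub>R norm g"
      have f: "norm f = 1" using g by (simp add: f_def)
      have a: "a f s = ennreal (1 / (norm g)\<^sup>2) * a g s" and b: "b f s = ennreal (1 / (norm g)\<^sup>2) * b g s" for s
        unfolding a_def b_def f_def
        by (simp_all add: ip_scaleR_left power_mult_distrib power_divide divide_inverse power_inverse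
            flip: ennreal_mult)
      have "weave_energy M F G K f
          = (\<integral>\<^sup>+s. ennreal (1 / (norm g)\<^sup>2) * (if s \<in> K then a g s else b g s) \<partial>M)"
        unfolding we[OF K] by (rule nn_integral_cong) (simp add: a b)
      also have "\<dots> = ennreal (1 / (norm g)\<^sup>2) * weave_energy M F G K g"
        unfolding we[OF K] by (rule nn_integral_cmult) (use K in measurable)
      also have "\<dots> \<le> ennreal (1 / (norm g)\<^sup>2) * ennreal (1 / real (Suc n) * (norm g)\<^sup>2)"
        by (rule mult_left_mono[OF less_imp_le[OF less]]) simp
      also have "\<dots> = ennreal (1 / real (Suc n))"
        using g by (simp flip: ennreal_mult)
      finally show ?thesis using K f by blast
    qed
    then obtain K f where K: "\<And>n. K n \<in> sets M" and f: "\<And>n. norm (f n) = 1"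
      and small: "\<And>n. weave_energy M F G (K n) (f n) \<le> ennreal (1 / real (Suc n))"
      by metis
    obtain r l where r: "strict_mono r" and l: "\<And>x. (\<lambda>n. ip (f (r n)) x) \<longlonglongrightarrow> ip l x"
      using weakly_convergent_subsequence[of f] f by auto
    have a_lim: "(\<lambda>n. a (f (r n)) s) \<longlonglongrightarrow> a l s" and b_lim: "(\<lambda>n. b (f (r n)) s) \<longlonglongrightarrow> b l s" for s
      unfolding a_def b_def by (intro tendsto_ennrealI tendsto_power tendsto_norm l)+
    define m where "m g s = min (a g s) (b g s)" for g s
    have [measurable]: "m g \<in> borel_measurable M" for g unfolding m_def by measurable
    have m_le: "(\<integral>\<^sup>+s. m (f n) s \<partial>M) \<le> ennreal (1 / real (Suc n))" for n
    proof -
      have "(\<integral>\<^sup>+s. m (f n) s \<partial>M) \<le> weave_energy M F G (K n) (f n)"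
        unfolding we[OF K] m_def by (rule nn_integral_mono) simp
      then show ?thesis using small[of n] by (rule order_trans)
    qed
    have m_lim: "(\<lambda>n. \<integral>\<^sup>+s. m (f (r n)) s \<partial>M) \<longlonglongrightarrow> 0"
    proof (rule tendsto_sandwich[OF _ _ tendsto_const])
      have "(\<lambda>n. ennreal (1 / real (Suc n))) \<longlonglongrightarrow> ennreal 0"
        by (intro tendsto_ennrealI LIMSEQ_Suc lim_const_over_n)
      then show "(\<lambda>n. ennreal (1 / real (Suc (r n)))) \<longlonglongrightarrow> 0"
        using LIMSEQ_subseq_LIMSEQ[OF _ r] by (fastforce simp: o_def)
      show "\<forall>\<^sub>F n in sequentially. (\<integral>\<^sup>+s. m (f (r n)) s \<partial>M) \<le> ennreal (1 / real (Suc (r n)))"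
        by (intro always_eventually allI m_le)
    qed simp
    have "l = 0"
    proof -
      have "(\<integral>\<^sup>+s. m l s \<partial>M) = (\<integral>\<^sup>+s. liminf (\<lambda>n. m (f (r n)) s) \<partial>M)"
        unfolding m_def
        by (intro nn_integral_cong lim_imp_Liminf[symmetric] tendsto_min a_lim b_lim) simp
      also have "\<dots> \<le> liminf (\<lambda>n. \<integral>\<^sup>+s. m (f (r n)) s \<partial>M)"
        by (rule nn_integral_liminf) simp
      also have "\<dots> = 0" by (rule lim_imp_Liminf[OF _ m_lim]) simp
      finally have zero: "(\<integral>\<^sup>+s. m l s \<partial>M) = 0" by simp
      \<comment> \<open>the weaving that is optimal for \<open>l\<close>\<close>
      define L where "L = {s \<in> space M. a l s \<le> b l s}"
      have L: "L \<in> sets M" unfolding L_def by measurable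
      have "weave_energy M F G L l = (\<integral>\<^sup>+s. m l s \<partial>M)"
        unfolding we[OF L] by (rule nn_integral_cong) (auto simp: L_def m_def min_def)
      moreover obtain c where "c > 0" "ennreal (c * (norm l)\<^sup>2) \<le> weave_energy M F G L l"
        using lower[OF L] by blast
      ultimately have "c * (norm l)\<^sup>2 \<le> 0" using zero by (simp add: ennreal_eq_0_iff)
      then show "l = 0" using \<open>c > 0\<close> by (simp add: mult_le_0_iff)
    qed
    define g where "g n s = a (f (r n)) s + b (f (r n)) s" for n s
    have "\<exists>q D. strict_mono q \<and> range D \<subseteq> sets M \<and> disjoint_family D \<and>
      (\<forall>j. (\<integral>\<^sup>+s\<in>space M - D j. g (q j) s \<partial>M) \<le> ennreal (2 * (1/2) ^ j))"
    proof (rule gliding_hump)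
      show "g n \<in> borel_measurable M" for n unfolding g_def by measurable
      show "(\<integral>\<^sup>+s. g n s \<partial>M) < \<infinity>" for n
      proof -
        have "(\<integral>\<^sup>+s. g n s \<partial>M) = (\<integral>\<^sup>+s. a (f (r n)) s \<partial>M) + (\<integral>\<^sup>+s. b (f (r n)) s \<partial>M)"
          unfolding g_def by (rule nn_integral_add) simp_all
        also have "\<dots> \<le> ennreal (B1 * (norm (f (r n)))\<^sup>2) + ennreal (B2 * (norm (f (r n)))\<^sup>2)"
          by (intro add_mono int_a int_b)
        also have "\<dots> < \<infinity>" by simp
        finally show ?thesis .
      qed
      have "ip 0 x = 0" for x using ip_add_left[of 0 0 x] by simp
      then have "a l s = 0" "b l s = 0" for s by (simp_all add: a_def b_def \<open>l = 0\<close>)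
      then show "(\<lambda>n. g n s) \<longlonglongrightarrow> 0" for s
        using tendsto_add[OF a_lim[of s] b_lim[of s]] by (simp add: g_def)
    qed
    then obtain q D where q: "strict_mono q" and D [measurable]: "\<And>j. D j \<in> sets M"
      and disj: "disjoint_family D"
      and tail: "\<And>j. (\<integral>\<^sup>+s\<in>space M - D j. g (q j) s \<partial>M) \<le> ennreal (2 * (1/2) ^ j)"
      by blast
    define h where "h j = f (r (q j))" for j
    define W where "W = (\<Union>j. {s \<in> D j. a (h j) s \<le> b (h j) s})"
    have sub: "{s \<in> D j. a (h j) s \<le> b (h j) s} \<in> sets M" for j
    proof -
      have "{s \<in> D j. a (h j) s \<le> b (h j) s} = D j \<inter> {s \<in> space M. a (h j) s \<le> b (h j) s}"
        using sets.sets_into_space[OF D] by blast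
      then show ?thesis by simp
    qed
    then have W: "W \<in> sets M" unfolding W_def by blast
    have bound: "weave_energy M F G W (h j)
        \<le> (\<integral>\<^sup>+s. m (h j) s \<partial>M) + (\<integral>\<^sup>+s\<in>space M - D j. g (q j) s \<partial>M)" for j
    proof -
      have [measurable]: "g n \<in> borel_measurable M" for n unfolding g_def by measurable
      have "weave_energy M F G W (h j)
          \<le> (\<integral>\<^sup>+s. m (h j) s + g (q j) s * indicator (space M - D j) s \<partial>M)"
        unfolding we[OF W]
      proof (rule nn_integral_mono)
        fix s assume s: "s \<in> space M"
        show "(if s \<in> W then a (h j) s else b (h j) s)
            \<le> m (h j) s + g (q j) s * indicator (space M - D j) s"
        proof (cases "s \<in> D j")
          case True
          then have "s \<in> D i \<longleftrightarrow> i = j" for i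
            using disj unfolding disjoint_family_on_def by blast
          then have "s \<in> W \<longleftrightarrow> a (h j) s \<le> b (h j) s" unfolding W_def by simp
          then show ?thesis by (auto simp: m_def min_def)
        next
          case False
          then have "(if s \<in> W then a (h j) s else b (h j) s) \<le> g (q j) s"
            by (simp add: g_def h_def)
          then show ?thesis using False s by (simp add: add_increasing)
        qed
      qed
      also have "\<dots> = (\<integral>\<^sup>+s. m (h j) s \<partial>M) + (\<integral>\<^sup>+s\<in>space M - D j. g (q j) s \<partial>M)"
        by (rule nn_integral_add) simp_all
      finally show ?thesis .
    qed
    have "(\<lambda>j. weave_energy M F G W (h j)) \<longlonglongrightarrow> 0"
    proof (rule tendsto_sandwich[OF _ _ tendsto_const])
      have "(\<lambda>j. 2 * (1/2::real) ^ j) \<longlonglongrightarrow> 2 * 0"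
        by (intro tendsto_mult tendsto_const LIMSEQ_power_zero) simp
      then have "(\<lambda>j. ennreal (2 * (1/2) ^ j)) \<longlonglongrightarrow> ennreal (2 * 0)"
        by (rule tendsto_ennrealI)
      moreover have "(\<lambda>j. \<integral>\<^sup>+s. m (h j) s \<partial>M) \<longlonglongrightarrow> 0"
        using LIMSEQ_subseq_LIMSEQ[OF m_lim q] by (simp add: o_def h_def)
      ultimately show "(\<lambda>j. (\<integral>\<^sup>+s. m (h j) s \<partial>M) + ennreal (2 * (1/2) ^ j)) \<longlonglongrightarrow> 0"
        using tendsto_add by fastforce
      show "\<forall>\<^sub>F j in sequentially. weave_energy M F G W (h j)
          \<le> (\<integral>\<^sup>+s. m (h j) s \<partial>M) + ennreal (2 * (1/2) ^ j)"
        by (intro always_eventually allI order_trans[OF bound] add_left_mono tail)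
    qed simp
    moreover obtain c where c: "c > 0" "\<And>x. ennreal (c * (norm x)\<^sup>2) \<le> weave_energy M F G W x"
      using lower[OF W] by blast
    moreover have "ennreal c \<le> weave_energy M F G W (h j)" for j
      using c(2)[of "h j"] f by (simp add: h_def)
    ultimately have "ennreal c \<le> 0" by (intro LIMSEQ_le_const) auto
    then show False using c(1) by simp
  qed
  then obtain A where A: "A > 0"
    and low: "\<And>K f. K \<in> sets M \<Longrightarrow> ennreal (A * (norm f)\<^sup>2) \<le> weave_energy M F G K f" by blast
  have up: "weave_energy M F G K f \<le> ennreal (max A (B1 + B2) * (norm f)\<^sup>2)"
    if "K \<in> sets M" for K f
    by (rule order_trans[OF upper[OF that]]) (intro ennreal_leI mult_right_mono, auto)
  show ?thesis
    unfolding continuous_woven_altdef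
    using F.weakly_measurable G.weakly_measurable A low up
    by (intro conjI exI[of _ A] exI[of _ "max A (B1 + B2)"]) auto
qed

lemma bessel_family_image:
  assumes F: "bessel_family smul ip M F B" and T': "bounded_linear T'"
    and adj: "\<And>x y. ip x (T y) = ip (T' x) y"
  shows "\<exists>C. bessel_family smul ip M (\<lambda>s. T (F s)) C"
proof -
  interpret F: bessel_family smul ip M F B by (rule F)
  obtain C where C: "0 \<le> C" "\<And>x. norm (T' x) \<le> norm x * C"
    using bounded_linear.nonneg_bounded[OF T'] by blast
  have "bessel_family smul ip M (\<lambda>s. T (F s)) (B * C\<^sup>2)"
  proof unfold_locales
    show "weakly_measurable ip M (\<lambda>s. T (F s))"
      unfolding weakly_measurable_def adj by simp
    show "0 \<le> B * C\<^sup>2" using F.B_nonneg by simp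
    fix f
    have "(\<integral>\<^sup>+s. ennreal ((norm (ip f (T (F s))))\<^sup>2) \<partial>M) \<le> ennreal (B * (norm (T' f))\<^sup>2)"
      unfolding adj by (rule F.bessel_bound)
    also have "\<dots> \<le> ennreal (B * (norm f * C)\<^sup>2)"
      using C F.B_nonneg by (intro ennreal_leI mult_left_mono power_mono) auto
    finally show "(\<integral>\<^sup>+s. ennreal ((norm (ip f (T (F s))))\<^sup>2) \<partial>M) \<le> ennreal (B * C\<^sup>2 * (norm f)\<^sup>2)"
      by (simp only: power_mult_distrib mult_ac)
  qed
  then show ?thesis by blast
qed

lemma dist_to_sphereD:
  assumes c: "ereal c < dist_to_sphere U V" and U: "subspace U" and V: "subspace V"
    and u: "u \<in> U" and v: "v \<in> V"
  shows "c * norm v \<le> norm (u + v)"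
proof (cases "v = 0")
  case False
  define n where "n = norm v"
  have n: "n > 0" using False by (simp add: n_def)
  have "(- 1 / n) *\<^sub>R u \<in> U" by (rule subspace_scale[OF U u])
  moreover have "(1 / n) *\<^sub>R v \<in> sphere 0 1 \<inter> V"
    using subspace_scale[OF V v, of "1 / n"] False by (simp add: n_def)
  ultimately have "dist_to_sphere U V \<le> ereal (norm ((- 1 / n) *\<^sub>R u - (1 / n) *\<^sub>R v))"
    unfolding dist_to_sphere_def by (intro Inf_lower) blast
  then have "c < norm ((- 1 / n) *\<^sub>R u - (1 / n) *\<^sub>R v)" using c by (meson ereal_less_eq(3) not_le order_trans)
  also have "(- 1 / n) *\<^sub>R u - (1 / n) *\<^sub>R v = (- 1 / n) *\<^sub>R (u + v)"
    by (simp add: scaleR_add_right)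
  also have "norm \<dots> = norm (u + v) / n" using n by (simp add: divide_inverse mult.commute)
  finally show ?thesis using n by (simp add: n_def field_simps)
qed simp

section \<open>Perturbed weavings\<close>

text \<open>
  Strictness of the distance hypothesis leaves room for a constant \<open>c\<close>, which depends on \<open>K\<close>, as
  required by \<open>perturbed_energy_lower_bound\<close>.
\<close>

lemma woven_perturbation:
  assumes woven: "continuous_woven ip M F G"
    and T1: "bounded_invertible_operator smul T1" and T2: "bounded_operator smul T2"
    and dist: "\<And>K. K \<in> sets M \<Longrightarrow> ereal (onorm (\<lambda>x. T1 x - T2 x) * onorm (inv T1))
      < dist_to_sphere (closed_span smul (F ` K)) (closed_span smul (G ` (space M - K)))"
  shows "continuous_woven ip M (\<lambda>s. T1 (F s)) (\<lambda>s. T2 (G s))"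
proof -
  obtain A B where wm: "weakly_measurable ip M F" "weakly_measurable ip M G" and AB: "0 < A" "A \<le> B"
    and lo: "\<And>K f. K \<in> sets M \<Longrightarrow> ennreal (A * (norm f)\<^sup>2) \<le> weave_energy M F G K f"
    and up: "\<And>K f. K \<in> sets M \<Longrightarrow> weave_energy M F G K f \<le> ennreal (B * (norm f)\<^sup>2)"
    using woven unfolding continuous_woven_altdef by blast
  have frame: "\<exists>B A. frame_family smul ip M (weave K F G) B A" if K: "K \<in> sets M" for K
    using AB lo[OF K] up[OF K] weakly_measurable_weave[OF K wm]
    by (intro frame_family_if_frame) (auto simp: continuous_frame_def weave_energy_eq[OF K wm])
  obtain T1' where T1': "bounded_linear T1'" and adj1: "\<And>x y. ip x (T1 y) = ip (T1' x) y"
    using adjoint_exists[of T1] T1 unfolding bounded_invertible_operator_def by blast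
  obtain T2' where T2': "bounded_linear T2'" and adj2: "\<And>x y. ip x (T2 y) = ip (T2' x) y"
    using adjoint_exists[OF T2] by blast
  have "bessel_family smul ip M F B"
  proof unfold_locales
    show "(\<integral>\<^sup>+s. ennreal ((norm (ip f (F s)))\<^sup>2) \<partial>M) \<le> ennreal (B * (norm f)\<^sup>2)" for f
      using up[of "space M" f] by (simp add: weave_energy_def)
  qed (use wm AB in auto)
  then obtain C1 where C1: "bessel_family smul ip M (\<lambda>s. T1 (F s)) C1"
    using bessel_family_image[OF _ T1' adj1] by blast
  have "bessel_family smul ip M G B"
  proof unfold_locales
    show "(\<integral>\<^sup>+s. ennreal ((norm (ip f (G s)))\<^sup>2) \<partial>M) \<le> ennreal (B * (norm f)\<^sup>2)" for f
      using up[of "{}" f] by (simp add: weave_energy_def)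
  qed (use wm AB in auto)
  then obtain C2 where C2: "bessel_family smul ip M (\<lambda>s. T2 (G s)) C2"
    using bessel_family_image[OF _ T2' adj2] by blast
  show ?thesis
  proof (rule woven_if_every_weaving_bounded_below[OF C1 C2])
    fix K assume K: "K \<in> sets M"
    then have K': "space M - K \<in> sets M" by simp
    obtain B' A' where "frame_family smul ip M (weave K F G) B' A'" using frame[OF K] by blast
    then interpret H: frame_family smul ip M "weave K F G" B' A' .
    have images: "weave K F G ` K = F ` K" "weave K F G ` (space M - K) = G ` (space M - K)"
      by (auto simp: weave_def)
    obtain c where c: "onorm (\<lambda>x. T1 x - T2 x) * onorm (inv T1) < c"
      and cd: "ereal c < dist_to_sphere (closed_span smul (F ` K)) (closed_span smul (G ` (space M - K)))"
      using ereal_dense2[OF dist[OF K]] by auto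
    obtain t where t: "t > 0"
      and lower: "\<And>f. t * (norm f)\<^sup>2 \<le> H.energy K (T1' f) + H.energy (space M - K) (T2' f)"
      using H.perturbed_energy_lower_bound[OF K adj1 adj2 T1 T2 _ c, unfolded images]
        dist_to_sphereD[OF cd closed_subspace_closed_span(2) closed_subspace_closed_span(2)] by blast
    have "weave_energy M (\<lambda>s. T1 (F s)) (\<lambda>s. T2 (G s)) K f
        = ennreal (H.energy K (T1' f) + H.energy (space M - K) (T2' f))" for f
    proof -
      have "weave_energy M (\<lambda>s. T1 (F s)) (\<lambda>s. T2 (G s)) K f
          = (\<integral>\<^sup>+s\<in>K. ennreal ((norm (ip (T1' f) (weave K F G s)))\<^sup>2) \<partial>M)
          + (\<integral>\<^sup>+s\<in>space M - K. ennreal ((norm (ip (T2' f) (weave K F G s)))\<^sup>2) \<partial>M)"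
        unfolding weave_energy_def adj1 adj2
        by (intro arg_cong2[of _ _ _ _ "(+)"] nn_integral_cong) (auto simp: weave_def split: split_indicator)
      then show ?thesis
        unfolding H.nn_integral_eq_energy[OF K] H.nn_integral_eq_energy[OF K']
        by (simp add: H.energy_nonneg flip: ennreal_plus)
    qed
    then show "\<exists>a>0. \<forall>f. ennreal (a * (norm f)\<^sup>2)
        \<le> weave_energy M (\<lambda>s. T1 (F s)) (\<lambda>s. T2 (G s)) K f"
      using t lower by (intro exI[of _ t]) (simp add: ennreal_leI)
  qed
qed

end

theorem theorem3p7:
  fixes smul :: "'k::rc_scalar \<Rightarrow> 'h::{banach, second_countable_topology} \<Rightarrow> 'h"
    and ip :: "'h \<Rightarrow> 'h \<Rightarrow> 'k"
    and M :: "'s measure"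
    and F G :: "'s \<Rightarrow> 'h"
  assumes hilbert: "separable_hilbert smul ip"
    and frame_F: "continuous_frame ip M F"
    and frame_G: "continuous_frame ip M G"
  shows
    "(operator_ge ip (inv (frame_op smul ip M F)) id \<and>
      (\<forall>K \<in> sets M. frame_op smul ip M F \<circ> partial_frame_op smul ip M F K =
                    partial_frame_op smul ip M F K \<circ> frame_op smul ip M F)
      \<longrightarrow> continuous_woven ip M F (\<lambda>s. inv (frame_op smul ip M F) (F s)))
     \<and>
     (continuous_riesz_basis smul ip M F \<and> continuous_riesz_basis smul ip M G \<and>
      continuous_woven ip M F G
      \<longrightarrow> (\<forall>T1 T2. bounded_invertible_operator smul T1 \<and> bounded_invertible_operator smul T2 \<and>
            (\<forall>K \<in> sets M.
               subspace_dist (closed_span smul (F ` K)) (closed_span smul (G ` (space M - K)))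
               > ereal (max (onorm (\<lambda>x. T1 x - T2 x) * onorm (inv T1))
                            (onorm (\<lambda>x. T1 x - T2 x) * onorm (inv T2))))
            \<longrightarrow> continuous_woven ip M (\<lambda>s. T1 (F s)) (\<lambda>s. T2 (G s))))"
proof (intro conjI impI allI; elim conjE)
  interpret separable_hilbert smul ip by (rule hilbert)
  {
    assume ge: "operator_ge ip (inv (frame_op smul ip M F)) id"
      and comm: "\<forall>K\<in>sets M. frame_op smul ip M F \<circ> partial_frame_op smul ip M F K =
        partial_frame_op smul ip M F K \<circ> frame_op smul ip M F"
    obtain B A where "frame_family smul ip M F B A" using frame_family_if_frame[OF frame_F] by blast
    then show "continuous_woven ip M F (\<lambda>s. inv (frame_op smul ip M F) (F s))"
      using ge comm by (intro frame_family.woven_canonical_dual) auto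
  next
    fix T1 T2
    assume woven: "continuous_woven ip M F G"
      and T1: "bounded_invertible_operator smul T1" and T2: "bounded_invertible_operator smul T2"
      and dist: "\<forall>K\<in>sets M. ereal (max (onorm (\<lambda>x. T1 x - T2 x) * onorm (inv T1))
          (onorm (\<lambda>x. T1 x - T2 x) * onorm (inv T2)))
        < subspace_dist (closed_span smul (F ` K)) (closed_span smul (G ` (space M - K)))"
    show "continuous_woven ip M (\<lambda>s. T1 (F s)) (\<lambda>s. T2 (G s))"
    proof (rule woven_perturbation[OF woven T1])
      show "bounded_operator smul T2" using T2 by (simp add: bounded_invertible_operator_def)
      fix K assume "K \<in> sets M"
      have "ereal (onorm (\<lambda>x. T1 x - T2 x) * onorm (inv T1))
          \<le> ereal (max (onorm (\<lambda>x. T1 x - T2 x) * onorm (inv T1))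
              (onorm (\<lambda>x. T1 x - T2 x) * onorm (inv T2)))" by simp
      also have "\<dots> < subspace_dist (closed_span smul (F ` K)) (closed_span smul (G ` (space M - K)))"
        using dist \<open>K \<in> sets M\<close> by blast
      also have "\<dots> \<le> dist_to_sphere (closed_span smul (F ` K)) (closed_span smul (G ` (space M - K)))"
        by (simp add: subspace_dist_def)
      finally show "ereal (onorm (\<lambda>x. T1 x - T2 x) * onorm (inv T1))
        < dist_to_sphere (closed_span smul (F ` K)) (closed_span smul (G ` (space M - K)))" .
    qed
  }
qed

end
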